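(* The following statements about the real field $\mathbb{R}$ are equivalent, where CC denotes the Countable Cofinality of $\mathbb{R}$: there exists a countably infinite cofinal subset of $\mathbb{R}$. (1) [UAS] Uniform Approximation by Step Functions: if $f$ is continuous on $[a,b]$, then for each $\varepsilon>0$, there exists a step function $\varphi:[a,b]\to\mathbb{R}$ such that for any $x\in[a,b]$, we have $|f(x)-\varphi(x)|<\varepsilon$. (2) [CC & DIT] The conjunction of CC and the Darboux Integral Theorem: if $f$ is continuous on $[a,b]$, then the lower Darboux integral $\underline{\int_a^b}f$ exists. (3) [CC & RIT] The conjunction of CC and the Riemann Integrability Theorem: if $f$ is continuous on $[a,b]$, then $f$ is Riemann integrable over $[a,b]$. (4) [CC & BVT] The conjunction of CC and the Bounded Value Theorem: if $f$ is continuous on $[a,b]$, then there exists $M\in\mathbb{R}$ such that $a\le x\le b$ implies $f(x)\le M$. (5) [MVT] Mean Value Theorem: if $f:[a,b]\to\mathbb{R}$ is continuous on $[a,b]$ and differentiable on $(a,b)$, then there exists $c\in(a,b)$ such that $f'(c)=\frac{f(b)-f(a)}{b-a}$. (6) [FTC1 & IAT] The conjunction of the Fundamental Theorem of Calculus, First Form: if $f$ is continuous on $[a,b]$, then the function $[a,b]\to\mathbb{R}$ denoted by $x\mapsto\int_a^xf$ is an antiderivative of $f$; and the Increasing Antiderivative Theorem: if $f$ is continuous and nonnegative on $[a,b]$, then any antiderivative of $f$ is monotonically increasing on $[a,b]$. (7) [FTC2] Fundamental Theorem of Calculus, Second Form: if $f$ is continuous on $[a,b]$ and $F$ is an antiderivative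 of $f$, then $\int_a^bf=F(b)-F(a)$. (8) [ADT] Antiderivative Difference Theorem: if $f$ is continuous on $[a,b]$ and if $F$ and $G$ are antiderivatives of $f$, then $F-G$ is a constant function. (9) [CVT] Constant Value Theorem: if $f'$ is zero on $(a,b)$, then $f$ is constant on $(a,b)$.
   Context: The setting is the real field $\mathbb{R}$; any one of the listed principles may be chosen as the completeness axiom for $\mathbb{R}$, and equivalence means that each principle is derived from each other one. A subset $S\subseteq\mathbb{R}$ is cofinal if for each $x\in\mathbb{R}$ there is $N\in S$ with $N>x$. A function $f:X\to\mathbb{R}$, $X\subseteq\mathbb{R}$, is continuous on $X$ if for each $c\in X$ and $\varepsilon>0$ there is $\delta>0$ such that $x\in X$, $|x-c|<\delta$ imply $|f(x)-f(c)|<\varepsilon$. It is differentiable at $c\in X$ with derivative $f'(c)=L\in\mathbb{R}$ if $\lim_{x\to c}\frac{f(x)-f(c)}{x-c}=L$, i.e. for each $\varepsilon>0$ there is $\delta>0$ such that $x\in X$, $0<|x-c|<\delta$ imply $\left|\frac{f(x)-f(c)}{x-c}-L\right|<\varepsilon$; here $c$ is an interior point of $X$, or, for antiderivatives on $[a,b]$, possibly an endpoint of $X=[a,b]$, where the limit is one-sided. $F$ is an antiderivative of $f$ if $f$ is the derivative of $F$ (on $[a,b]$). $F$ is monotonically increasing on $[a,b]$ if $a\le c<x\le b$ implies $F(c)\le F(x)$. Given $a\le b$ (the degenerate case $a=b$ is allowed for integrals), a partition of $[a,b]$ is a finite subset of $[a,b]$ containing $a$ and $b$, written $a=x_0<x_1<\dots<x_n=b$.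 A function $\varphi:[a,b]\to\mathbb{R}$ is a step function if there is a partition $\{x_0,\dots,x_n\}$ such that for each $k\in\{1,\dots,n\}$, $\varphi$ has a constant value $c_k$ on $(x_{k-1},x_k)$; its integral is $\int_a^b\varphi=\sum_{k=1}^nc_k(x_k-x_{k-1})$, which does not depend on the choice of such a partition. Let $\mathscr{S}[a,b]$ be the set of all step functions on $[a,b]$; inequalities between functions are pointwise. The lower and upper Darboux integrals of $f$ over $[a,b]$ are $$\underline{\int_a^b}f=\sup\left\{\int_a^b\varphi:\varphi\in\mathscr{S}[a,b],\ \varphi\le f\right\},\qquad\overline{\int_a^b}f=-\sup\left\{\int_a^b\varphi:\varphi\in\mathscr{S}[a,b],\ \varphi\le-f\right\},$$ each existing when the corresponding supremum (least upper bound) exists in $\mathbb{R}$. $f$ is Riemann integrable over $[a,b]$ if both exist and are equal. For a partition $\Omega=\{x_0,\dots,x_n\}$ of $[a,b]$ and a choice $\xi$ of points $\xi_k\in[x_{k-1},x_k]$, put $\mathcal{R}(f,\Omega,\xi)=\sum_{k=1}^nf(\xi_k)(x_k-x_{k-1})$. The Riemann integral $\int_a^bf$ is the (necessarily unique) $I\in\mathbb{R}$, if it exists, that is approached by the filter base of the sets $\Sigma_\Delta=\{\mathcal{R}(f,\Omega,\xi):\Omega\supseteq\Delta\}$ ($\Delta$ a partition of $[a,b]$; $\Omega$ ranging over partitions of $[a,b]$ and $\xi$ over choices for $\Omega$): for each $\varepsilon>0$ there is a partition $\Delta$ with $\Sigma_\Delta\subseteq(I-\varepsilon,I+\varepsilon)$.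 One has $\int_a^af=0$. In (5) and in the first statement of (6), $a<b$ is understood. *)

theory Defs
  imports Main "HOL-Library.Lub_Glb" "HOL-Library.Countable_Set"
begin

text \<open>
  The principles below are meant as candidate completeness axioms, so none of them may be
  stated over the type of real numbers, where completeness is already available and all of them
  hold. The ground structure is an arbitrary ordered field \<open>'a :: linordered_field\<close>. This class
  carries no topology and no suprema, so limits are spelled out in \<open>\<epsilon>\<close>-\<open>\<delta>\<close> form with \<open>\<epsilon>, \<delta>\<close>
  in the field itself, and least upper bounds are expressed by the relation \<^const>\<open>isLub\<close>.
  Functions on a subset of the field are total functions, of which only the values on that
  subset matter.
\<close>

subsection \<open>Continuity, derivatives and antiderivatives\<close>

definition cofinal_set :: "'a::linordered_field set \<Rightarrow> bool" where
  "cofinal_set S \<longleftrightarrow> (\<forall>x. \<exists>N\<in>S. N > x)"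

definition cont_on :: "'a::linordered_field set \<Rightarrow> ('a \<Rightarrow> 'a) \<Rightarrow> bool" where
  "cont_on X f \<longleftrightarrow>
     (\<forall>c\<in>X. \<forall>\<epsilon>>0. \<exists>\<delta>>0. \<forall>x\<in>X. \<bar>x - c\<bar> < \<delta> \<longrightarrow> \<bar>f x - f c\<bar> < \<epsilon>)"

text \<open>\<open>has_deriv_on X f c L\<close>: the function \<open>f\<close> with domain \<open>X\<close> has derivative \<open>L\<close> at \<open>c\<close>;
  one-sided if \<open>c\<close> is an endpoint of the interval \<open>X\<close>.\<close>

definition has_deriv_on ::
    "'a::linordered_field set \<Rightarrow> ('a \<Rightarrow> 'a) \<Rightarrow> 'a \<Rightarrow> 'a \<Rightarrow> bool" where
  "has_deriv_on X f c L \<longleftrightarrow>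
     (\<forall>\<epsilon>>0. \<exists>\<delta>>0. \<forall>x\<in>X.
        0 < \<bar>x - c\<bar> \<and> \<bar>x - c\<bar> < \<delta> \<longrightarrow> \<bar>(f x - f c) / (x - c) - L\<bar> < \<epsilon>)"

definition antiderivative_on ::
    "'a::linordered_field \<Rightarrow> 'a \<Rightarrow> ('a \<Rightarrow> 'a) \<Rightarrow> ('a \<Rightarrow> 'a) \<Rightarrow> bool" where
  "antiderivative_on a b F f \<longleftrightarrow> (\<forall>c\<in>{a..b}. has_deriv_on {a..b} F c (f c))"

subsection \<open>Partitions and step functions\<close>

definition is_partition :: "'a::linordered_field \<Rightarrow> 'a \<Rightarrow> 'a set \<Rightarrow> bool" where
  "is_partition a b P \<longleftrightarrow> finite P \<and> P \<subseteq> {a..b} \<and> a \<in> P \<and> b \<in> P"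

text \<open>A partition \<open>P = {x\<^sub>0 < \<dots> < x\<^sub>n}\<close> has \<open>x\<^sub>k = part_pt P k\<close> and \<open>n = card P - 1\<close>
  (with \<open>n = 0\<close> if \<open>a = b\<close>).\<close>

definition part_pt :: "'a::linordered_field set \<Rightarrow> nat \<Rightarrow> 'a" where
  "part_pt P k = sorted_list_of_set P ! k"

text \<open>\<open>step_on a b P c \<phi>\<close>: \<open>\<phi>\<close> has the constant value \<open>c k\<close> on the \<open>k\<close>-th open subinterval
  of \<open>P\<close>; its values at the points of \<open>P\<close> are arbitrary.\<close>

definition step_on ::
    "'a::linordered_field \<Rightarrow> 'a \<Rightarrow> 'a set \<Rightarrow> (nat \<Rightarrow> 'a) \<Rightarrow> ('a \<Rightarrow> 'a) \<Rightarrow> bool" where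
  "step_on a b P c \<phi> \<longleftrightarrow> is_partition a b P \<and>
     (\<forall>k\<in>{1..card P - 1}. \<forall>x\<in>{part_pt P (k - 1)<..<part_pt P k}. \<phi> x = c k)"

definition step_function :: "'a::linordered_field \<Rightarrow> 'a \<Rightarrow> ('a \<Rightarrow> 'a) \<Rightarrow> bool" where
  "step_function a b \<phi> \<longleftrightarrow> (\<exists>P c. step_on a b P c \<phi>)"

definition step_integral :: "'a::linordered_field \<Rightarrow> 'a \<Rightarrow> ('a \<Rightarrow> 'a) \<Rightarrow> 'a" where
  "step_integral a b \<phi> =
     (THE s. \<exists>P c. step_on a b P c \<phi> \<and>
        s = (\<Sum>k=1..card P - 1. c k * (part_pt P k - part_pt P (k - 1))))"

subsection \<open>Darboux integrals\<close>

definition lower_step_integrals ::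
    "'a::linordered_field \<Rightarrow> 'a \<Rightarrow> ('a \<Rightarrow> 'a) \<Rightarrow> 'a set" where
  "lower_step_integrals a b f =
     {step_integral a b \<phi> | \<phi>. step_function a b \<phi> \<and> (\<forall>x\<in>{a..b}. \<phi> x \<le> f x)}"

definition has_lower_integral ::
    "'a::linordered_field \<Rightarrow> 'a \<Rightarrow> ('a \<Rightarrow> 'a) \<Rightarrow> 'a \<Rightarrow> bool" where
  "has_lower_integral a b f I \<longleftrightarrow> isLub UNIV (lower_step_integrals a b f) I"

definition has_upper_integral ::
    "'a::linordered_field \<Rightarrow> 'a \<Rightarrow> ('a \<Rightarrow> 'a) \<Rightarrow> 'a \<Rightarrow> bool" where
  "has_upper_integral a b f I \<longleftrightarrow>
     (\<exists>s. isLub UNIV (lower_step_integrals a b (\<lambda>x. - f x)) s \<and> I = - s)"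

definition riemann_integrable :: "'a::linordered_field \<Rightarrow> 'a \<Rightarrow> ('a \<Rightarrow> 'a) \<Rightarrow> bool" where
  "riemann_integrable a b f \<longleftrightarrow> (\<exists>I. has_lower_integral a b f I \<and> has_upper_integral a b f I)"

subsection \<open>The Riemann integral\<close>

definition is_tagging :: "'a::linordered_field set \<Rightarrow> (nat \<Rightarrow> 'a) \<Rightarrow> bool" where
  "is_tagging P \<xi> \<longleftrightarrow> (\<forall>k\<in>{1..card P - 1}. \<xi> k \<in> {part_pt P (k - 1)..part_pt P k})"

definition riemann_sum ::
    "('a::linordered_field \<Rightarrow> 'a) \<Rightarrow> 'a set \<Rightarrow> (nat \<Rightarrow> 'a) \<Rightarrow> 'a" where
  "riemann_sum f P \<xi> = (\<Sum>k=1..card P - 1. f (\<xi> k) * (part_pt P k - part_pt P (k - 1)))"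

definition riemann_sums_beyond ::
    "'a::linordered_field \<Rightarrow> 'a \<Rightarrow> ('a \<Rightarrow> 'a) \<Rightarrow> 'a set \<Rightarrow> 'a set" where
  "riemann_sums_beyond a b f \<Delta> =
     {riemann_sum f \<Omega> \<xi> | \<Omega> \<xi>. is_partition a b \<Omega> \<and> is_tagging \<Omega> \<xi> \<and> \<Delta> \<subseteq> \<Omega>}"

definition has_riemann_integral ::
    "'a::linordered_field \<Rightarrow> 'a \<Rightarrow> ('a \<Rightarrow> 'a) \<Rightarrow> 'a \<Rightarrow> bool" where
  "has_riemann_integral a b f I \<longleftrightarrow>
     (\<forall>\<epsilon>>0. \<exists>\<Delta>. is_partition a b \<Delta> \<and> riemann_sums_beyond a b f \<Delta> \<subseteq> {I - \<epsilon><..<I + \<epsilon>})"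

definition riemann_integral :: "'a::linordered_field \<Rightarrow> 'a \<Rightarrow> ('a \<Rightarrow> 'a) \<Rightarrow> 'a" where
  "riemann_integral a b f = (THE I. has_riemann_integral a b f I)"

subsection \<open>The principles\<close>

text \<open>Each principle is a property of an ordered field, passed as a type argument
  \<open>TYPE('a)\<close>. A claim involving an integral includes that the integral exists.\<close>

definition CC :: "'a::linordered_field itself \<Rightarrow> bool" where
  "CC _ \<longleftrightarrow> (\<exists>S :: 'a set. countable S \<and> infinite S \<and> cofinal_set S)"

definition UAS :: "'a::linordered_field itself \<Rightarrow> bool" where
  "UAS _ \<longleftrightarrow> (\<forall>(a::'a) b f. a \<le> b \<and> cont_on {a..b} f \<longrightarrow>
     (\<forall>\<epsilon>>0. \<exists>\<phi>. step_function a b \<phi> \<and> (\<forall>x\<in>{a..b}. \<bar>f x - \<phi> x\<bar> < \<epsilon>)))"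

definition DIT :: "'a::linordered_field itself \<Rightarrow> bool" where
  "DIT _ \<longleftrightarrow> (\<forall>(a::'a) b f. a \<le> b \<and> cont_on {a..b} f \<longrightarrow> (\<exists>I. has_lower_integral a b f I))"

definition RIT :: "'a::linordered_field itself \<Rightarrow> bool" where
  "RIT _ \<longleftrightarrow> (\<forall>(a::'a) b f. a \<le> b \<and> cont_on {a..b} f \<longrightarrow> riemann_integrable a b f)"

definition BVT :: "'a::linordered_field itself \<Rightarrow> bool" where
  "BVT _ \<longleftrightarrow> (\<forall>(a::'a) b f. a \<le> b \<and> cont_on {a..b} f \<longrightarrow> (\<exists>M. \<forall>x\<in>{a..b}. f x \<le> M))"

definition MVT :: "'a::linordered_field itself \<Rightarrow> bool" where
  "MVT _ \<longleftrightarrow> (\<forall>(a::'a) b f.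
     a < b \<and> cont_on {a..b} f \<and> (\<forall>c\<in>{a<..<b}. \<exists>L. has_deriv_on {a..b} f c L) \<longrightarrow>
     (\<exists>c\<in>{a<..<b}. has_deriv_on {a..b} f c ((f b - f a) / (b - a))))"

definition FTC1 :: "'a::linordered_field itself \<Rightarrow> bool" where
  "FTC1 _ \<longleftrightarrow> (\<forall>(a::'a) b f. a < b \<and> cont_on {a..b} f \<longrightarrow>
     (\<forall>x\<in>{a..b}. \<exists>I. has_riemann_integral a x f I) \<and>
     antiderivative_on a b (\<lambda>x. riemann_integral a x f) f)"

definition IAT :: "'a::linordered_field itself \<Rightarrow> bool" where
  "IAT _ \<longleftrightarrow> (\<forall>(a::'a) b f F.
     a \<le> b \<and> cont_on {a..b} f \<and> (\<forall>x\<in>{a..b}. 0 \<le> f x) \<and> antiderivative_on a b F f \<longrightarrow>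
     mono_on {a..b} F)"

definition FTC2 :: "'a::linordered_field itself \<Rightarrow> bool" where
  "FTC2 _ \<longleftrightarrow> (\<forall>(a::'a) b f F.
     a \<le> b \<and> cont_on {a..b} f \<and> antiderivative_on a b F f \<longrightarrow>
     (\<exists>I. has_riemann_integral a b f I) \<and> riemann_integral a b f = F b - F a)"

definition ADT :: "'a::linordered_field itself \<Rightarrow> bool" where
  "ADT _ \<longleftrightarrow> (\<forall>(a::'a) b f F G.
     a \<le> b \<and> cont_on {a..b} f \<and> antiderivative_on a b F f \<and> antiderivative_on a b G f \<longrightarrow>
     (\<exists>k. \<forall>x\<in>{a..b}. F x - G x = k))"

definition CVT :: "'a::linordered_field itself \<Rightarrow> bool" where
  "CVT _ \<longleftrightarrow> (\<forall>(a::'a) b f.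
     a < b \<and> (\<forall>c\<in>{a<..<b}. has_deriv_on {a<..<b} f c 0) \<longrightarrow>
     (\<exists>k. \<forall>x\<in>{a<..<b}. f x = k))"

end

theory Submission
  imports Defs
begin

text \<open>
  Every principle is shown to be equivalent to Dedekind completeness of the ordered field: each
  nonempty set with an upper bound has a least upper bound.

  \<^bold>\<open>From a principle to completeness.\<close> If completeness fails, the field has a gap: a nonempty
  proper downward closed set \<open>A\<close> without maximum, whose complement has no minimum. The jump function,
  which is 0 on \<open>A\<close> and 1 off \<open>A\<close>, is then locally constant, hence continuous with derivative zero
  everywhere. It contradicts MVT, IAT, FTC2, ADT and CVT directly. It also contradicts UAS, because
  a step function is constant on some interval that meets both sides of the gap. For the three
  principles coupled with CC, RIT implies DIT, and DIT implies BVT, because the supremum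
  that defines a lower integral exists only if there is some step function below \<open>f\<close>. It remains to
  construct an unbounded continuous function. A monotone cofinal sequence, obtained from CC, supplies
  the values of a locally constant function whose jumps lie at countably many gaps, chosen so that
  their union is again a gap (\<open>gap_exhaustion_imp_not_BVT\<close>). Such a family of gaps is found by
  different means in the Archimedean and the non-Archimedean case.

  \<^bold>\<open>From completeness to the principles.\<close> A property of intervals that is stable under joining
  adjacent intervals and holds around every point holds on \<open>[a, b]\<close> (\<open>interval_induction\<close>). This
  gives maxima of continuous functions, hence BVT and MVT, and from MVT the statements IAT, ADT and
  CVT. It also gives partitions on whose cells \<open>f\<close> varies by less than \<open>\<epsilon>\<close>. Over these each Riemann sum
  is the integral of a step function within \<open>\<epsilon>\<close> of \<open>f\<close> (\<open>riemann_sum_as_step_integral\<close>). Since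
  integrals of step functions are monotone (\<open>step_sum_mono\<close>), the supremum of the lower sums exists
  and is the Riemann integral. Applied to \<open>f\<close> and to \<open>- f\<close> this gives RIT; bounds and additivity of
  the integral give FTC1, and FTC2 follows by ADT.
\<close>

section \<open>Gaps and completeness\<close>

text \<open>A gap is the lower half of a Dedekind cut that no element of the field produces.\<close>

definition gap :: "'a::linordered_field set \<Rightarrow> bool" where
  "gap A \<longleftrightarrow> A \<noteq> {} \<and> A \<noteq> UNIV \<and> (\<forall>x\<in>A. \<forall>y. y \<le> x \<longrightarrow> y \<in> A) \<and>
     (\<forall>x\<in>A. \<exists>y\<in>A. x < y) \<and> (\<forall>x. x \<notin> A \<longrightarrow> (\<exists>y. y \<notin> A \<and> y < x))"

definition dedekind_complete :: "'a::linordered_field itself \<Rightarrow> bool" where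
  "dedekind_complete _ \<longleftrightarrow>
     (\<forall>S::'a set. S \<noteq> {} \<longrightarrow> (\<exists>u. \<forall>x\<in>S. x \<le> u) \<longrightarrow> (\<exists>s. isLub UNIV S s))"

lemma isLub_iff:
  "isLub UNIV S s \<longleftrightarrow> (\<forall>x\<in>S. x \<le> s) \<and> (\<forall>u. (\<forall>x\<in>S. x \<le> u) \<longrightarrow> s \<le> (u::'a::linordered_field))"
  by (auto simp: isLub_def leastP_def isUb_def setle_def setge_def)

text \<open>The downward closure of a set without least upper bound is a gap: a maximum of the closure or
  a minimum of its complement would be a least upper bound.\<close>

lemma not_complete_imp_gap:
  assumes "\<not> dedekind_complete TYPE('a::linordered_field)"
  shows "\<exists>A::'a set. gap A"
proof -
  obtain S :: "'a set" and u where S: "S \<noteq> {}" "\<forall>x\<in>S. x \<le> u" "\<And>s. \<not> isLub UNIV S s"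
    using assms unfolding dedekind_complete_def by auto
  define A where "A = {x. \<exists>s\<in>S. x \<le> s}"
  have "\<exists>y\<in>A. x < y" if "x \<in> A" for x
  proof (rule ccontr)
    assume "\<not> ?thesis"
    then have "isLub UNIV S x"
      using that by (force simp: A_def isLub_iff not_less)
    then show False using S(3) by blast
  qed
  moreover have "\<exists>y. y \<notin> A \<and> y < x" if "x \<notin> A" for x
  proof (rule ccontr)
    assume no: "\<not> ?thesis"
    have "x \<le> v" if "\<forall>s\<in>S. s \<le> v" for v
    proof (rule ccontr)
      assume "\<not> x \<le> v"
      then obtain y where "v < y" "y < x" using dense[of v x] by auto
      then have "y \<in> A" using no by auto
      then show False using that \<open>v < y\<close> unfolding A_def by force
    qed
    then have "isLub UNIV S x"
      using that unfolding isLub_iff A_def by force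
    then show False using S(3) by blast
  qed
  moreover have "u + 1 \<notin> A" using S(2) unfolding A_def by force
  moreover have "A \<noteq> {}" using S(1) unfolding A_def by auto
  moreover have "\<forall>x\<in>A. \<forall>y. y \<le> x \<longrightarrow> y \<in> A" unfolding A_def by (blast intro: order_trans)
  ultimately have "gap A" unfolding gap_def by blast
  then show ?thesis by blast
qed

lemma gap_less: "gap A \<Longrightarrow> x \<in> A \<Longrightarrow> y \<notin> A \<Longrightarrow> x < y"
  unfolding gap_def by (meson not_less)

lemma gap_member_locally_constant:
  assumes "gap A"
  shows "\<exists>\<delta>>0. \<forall>y. \<bar>y - x\<bar> < \<delta> \<longrightarrow> (y \<in> A \<longleftrightarrow> x \<in> A)"
proof (cases "x \<in> A")
  case True
  then obtain z where z: "z \<in> A" "x < z" using assms unfolding gap_def by blast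
  have "y \<in> A" if "\<bar>y - x\<bar> < z - x" for y
  proof -
    have "y \<le> z" using that by (simp add: abs_less_iff)
    then show ?thesis using assms z unfolding gap_def by blast
  qed
  then show ?thesis using z True by (intro exI[of _ "z - x"]) auto
next
  case False
  then obtain z where z: "z \<notin> A" "z < x" using assms unfolding gap_def by blast
  have "y \<notin> A" if "\<bar>y - x\<bar> < x - z" for y
  proof -
    have "z \<le> y" using that by (simp add: abs_less_iff)
    then show ?thesis using assms z unfolding gap_def by blast
  qed
  then show ?thesis using z False by (intro exI[of _ "x - z"]) auto
qed

text \<open>Continuity and vanishing derivative come for free for locally constant functions, with the
  same \<open>\<delta>\<close> for every \<open>\<epsilon>\<close>. All counterexamples below are of this kind.\<close>

definition locally_constant_on :: "'a::linordered_field set \<Rightarrow> ('a \<Rightarrow> 'a) \<Rightarrow> bool" where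
  "locally_constant_on X f \<longleftrightarrow> (\<forall>c\<in>X. \<exists>\<delta>>0. \<forall>x\<in>X. \<bar>x - c\<bar> < \<delta> \<longrightarrow> f x = f c)"

lemma locally_constant_imp_cont: "locally_constant_on X f \<Longrightarrow> cont_on X f"
  unfolding locally_constant_on_def cont_on_def
  by (metis abs_zero cancel_comm_monoid_add_class.diff_cancel)

lemma locally_constant_imp_deriv: "locally_constant_on X f \<Longrightarrow> c \<in> X \<Longrightarrow> has_deriv_on X f c 0"
  unfolding locally_constant_on_def has_deriv_on_def
  by (metis abs_zero cancel_comm_monoid_add_class.diff_cancel div_0)

definition jump :: "'a::linordered_field set \<Rightarrow> 'a \<Rightarrow> 'a" where
  "jump A x = (if x \<in> A then 0 else 1)"

lemma jump_locally_constant: "gap A \<Longrightarrow> locally_constant_on X (jump A)"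
  unfolding locally_constant_on_def jump_def using gap_member_locally_constant by metis

lemma jump_antiderivative: "gap A \<Longrightarrow> antiderivative_on a b (jump A) (\<lambda>x. 0)"
  unfolding antiderivative_on_def
  by (simp add: locally_constant_imp_deriv jump_locally_constant)

lemma cont_on_const: "cont_on X (\<lambda>x. k)"
  unfolding cont_on_def by (auto intro: exI[of _ 1])

lemma const_antiderivative: "antiderivative_on a b (\<lambda>x. k) (\<lambda>x. 0)"
  unfolding antiderivative_on_def has_deriv_on_def by (auto intro: exI[of _ 1])

lemma gap_endpoints:
  assumes "gap A"
  obtains a b where "a \<in> A" "b \<notin> A" "a < b"
proof -
  obtain a b where "a \<in> A" "b \<notin> A" using assms unfolding gap_def by blast
  then show ?thesis using that gap_less[OF assms] by blast
qed

section \<open>Derivatives\<close>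

lemma has_deriv_on_subset: "has_deriv_on Y f c L \<Longrightarrow> X \<subseteq> Y \<Longrightarrow> has_deriv_on X f c L"
  unfolding has_deriv_on_def by (meson subsetD)

lemma cont_on_subset: "cont_on Y f \<Longrightarrow> X \<subseteq> Y \<Longrightarrow> cont_on X f"
  unfolding cont_on_def by (meson subsetD)

lemma has_deriv_on_imp_cont:
  assumes "\<And>c. c \<in> X \<Longrightarrow> \<exists>L. has_deriv_on X f c L"
  shows "cont_on X f"
  unfolding cont_on_def
proof (intro ballI allI impI)
  fix c \<epsilon> :: 'a assume c: "c \<in> X" and \<epsilon>: "\<epsilon> > 0"
  obtain L where "has_deriv_on X f c L" using assms[OF c] by blast
  then obtain \<delta> where \<delta>: "\<delta> > 0"
    "\<And>x. x \<in> X \<Longrightarrow> 0 < \<bar>x - c\<bar> \<Longrightarrow> \<bar>x - c\<bar> < \<delta> \<Longrightarrow> \<bar>(f x - f c) / (x - c) - L\<bar> < 1"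
    unfolding has_deriv_on_def by (metis zero_less_one)
  define K where "K = \<bar>L\<bar> + 1"
  have K: "K > 0" unfolding K_def by (simp add: add_nonneg_pos)
  show "\<exists>\<delta>>0. \<forall>x\<in>X. \<bar>x - c\<bar> < \<delta> \<longrightarrow> \<bar>f x - f c\<bar> < \<epsilon>"
  proof (intro exI[of _ "min \<delta> (\<epsilon> / K)"] conjI ballI impI)
    show "min \<delta> (\<epsilon> / K) > 0" using \<delta>(1) \<epsilon> K by simp
    fix x assume x: "x \<in> X" "\<bar>x - c\<bar> < min \<delta> (\<epsilon> / K)"
    show "\<bar>f x - f c\<bar> < \<epsilon>"
    proof (cases "x = c")
      case True
      then show ?thesis using \<epsilon> by simp
    next
      case False
      have "\<bar>(f x - f c) / (x - c) - L\<bar> < 1" using \<delta>(2) x False by simp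
      then have "\<bar>(f x - f c) / (x - c)\<bar> \<le> K" unfolding K_def by (simp add: abs_if split: if_splits)
      then have "\<bar>f x - f c\<bar> \<le> K * \<bar>x - c\<bar>"
        using False by (simp add: abs_divide divide_le_eq)
      also have "\<dots> < \<epsilon>" using x(2) K by (simp add: pos_less_divide_eq mult.commute)
      finally show ?thesis .
    qed
  qed
qed

lemma has_deriv_on_diff:
  assumes "has_deriv_on X f c L" "has_deriv_on X g c M"
  shows "has_deriv_on X (\<lambda>x. f x - g x) c (L - M)"
  unfolding has_deriv_on_def
proof (intro allI impI)
  fix \<epsilon> :: 'a assume "\<epsilon> > 0"
  then have e2: "\<epsilon> / 2 > 0" by simp
  obtain d where d: "d > 0"
    "\<And>x. x \<in> X \<Longrightarrow> 0 < \<bar>x - c\<bar> \<Longrightarrow> \<bar>x - c\<bar> < d \<Longrightarrow> \<bar>(f x - f c) / (x - c) - L\<bar> < \<epsilon> / 2"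
    using assms(1) e2 unfolding has_deriv_on_def by metis
  obtain d' where d': "d' > 0"
    "\<And>x. x \<in> X \<Longrightarrow> 0 < \<bar>x - c\<bar> \<Longrightarrow> \<bar>x - c\<bar> < d' \<Longrightarrow> \<bar>(g x - g c) / (x - c) - M\<bar> < \<epsilon> / 2"
    using assms(2) e2 unfolding has_deriv_on_def by metis
  show "\<exists>\<delta>>0. \<forall>x\<in>X. 0 < \<bar>x - c\<bar> \<and> \<bar>x - c\<bar> < \<delta> \<longrightarrow>
          \<bar>(f x - g x - (f c - g c)) / (x - c) - (L - M)\<bar> < \<epsilon>"
  proof (intro exI[of _ "min d d'"] conjI ballI impI)
    show "min d d' > 0" using d(1) d'(1) by simp
    fix x assume x: "x \<in> X" "0 < \<bar>x - c\<bar> \<and> \<bar>x - c\<bar> < min d d'"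
    have "\<bar>(f x - f c) / (x - c) - L\<bar> < \<epsilon> / 2" "\<bar>(g x - g c) / (x - c) - M\<bar> < \<epsilon> / 2"
      using d(2) d'(2) x by auto
    moreover have eq: "(f x - g x - (f c - g c)) / (x - c) - (L - M)
        = ((f x - f c) / (x - c) - L) - ((g x - g c) / (x - c) - M)"
      by (simp add: diff_divide_distrib)
    moreover have "\<bar>p - q\<bar> < \<epsilon>" if "\<bar>p\<bar> < \<epsilon> / 2" "\<bar>q\<bar> < \<epsilon> / 2" for p q :: 'a
      using abs_triangle_ineq4[of p q] add_strict_mono[OF that] by simp
    ultimately show "\<bar>(f x - g x - (f c - g c)) / (x - c) - (L - M)\<bar> < \<epsilon>"
      unfolding eq by blast
  qed
qed

lemma interval_point_right_near:
  assumes "(c::'a::linordered_field) < b" "\<delta> > 0"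
  obtains x where "c < x" "x < b" "\<bar>x - c\<bar> < \<delta>"
proof -
  obtain x where "c < x" "x < min b (c + \<delta>)" using dense[of c "min b (c + \<delta>)"] assms by auto
  then show ?thesis using that by (simp add: abs_less_iff)
qed

lemma interval_point_left_near:
  assumes "a < (c::'a::linordered_field)" "\<delta> > 0"
  obtains x where "a < x" "x < c" "\<bar>x - c\<bar> < \<delta>"
proof -
  obtain x where "max a (c - \<delta>) < x" "x < c" using dense[of "max a (c - \<delta>)" c] assms by auto
  then show ?thesis using that[of x] by (auto simp: abs_less_iff algebra_simps)
qed

lemma has_deriv_on_unique:
  assumes "has_deriv_on X f c L" "has_deriv_on X f c M" "c < b" "{c..b} \<subseteq> X"
  shows "L = M"
proof (rule ccontr)
  assume "L \<noteq> M"
  then have e: "\<bar>L - M\<bar> / 2 > 0" by simp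
  obtain d where d: "d > 0" "\<And>x. x \<in> X \<Longrightarrow> 0 < \<bar>x - c\<bar> \<Longrightarrow> \<bar>x - c\<bar> < d \<Longrightarrow>
      \<bar>(f x - f c) / (x - c) - L\<bar> < \<bar>L - M\<bar> / 2"
    using assms(1) e unfolding has_deriv_on_def by metis
  obtain d' where d': "d' > 0" "\<And>x. x \<in> X \<Longrightarrow> 0 < \<bar>x - c\<bar> \<Longrightarrow> \<bar>x - c\<bar> < d' \<Longrightarrow>
      \<bar>(f x - f c) / (x - c) - M\<bar> < \<bar>L - M\<bar> / 2"
    using assms(2) e unfolding has_deriv_on_def by metis
  obtain x where x: "c < x" "x < b" "\<bar>x - c\<bar> < min d d'"
    using interval_point_right_near[of c b "min d d'"] assms(3) d(1) d'(1) by auto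
  have "x \<in> X" using x assms(4) by force
  define q where "q = (f x - f c) / (x - c)"
  have "\<bar>q - L\<bar> < \<bar>L - M\<bar> / 2" "\<bar>q - M\<bar> < \<bar>L - M\<bar> / 2"
    using d(2)[OF \<open>x \<in> X\<close>] d'(2)[OF \<open>x \<in> X\<close>] x unfolding q_def by auto
  then show False by (simp add: abs_if field_simps split: if_splits)
qed

section \<open>Consequences of the Mean Value Theorem\<close>

lemma MVT_imp_CVT:
  assumes "MVT TYPE('a::linordered_field)"
  shows "CVT TYPE('a)"
  unfolding CVT_def
proof (intro allI impI)
  fix a b :: 'a and f assume H: "a < b \<and> (\<forall>c\<in>{a<..<b}. has_deriv_on {a<..<b} f c 0)"
  have eq: "f x = f y" if xy: "a < x" "x < y" "y < b" for x y
  proof -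
    have sub: "{x..y} \<subseteq> {a<..<b}" using xy by auto
    have d: "has_deriv_on {x..y} f c 0" if "c \<in> {x..y}" for c
      using H sub that has_deriv_on_subset by blast
    then have "cont_on {x..y} f" using has_deriv_on_imp_cont by blast
    moreover have "\<forall>c\<in>{x<..<y}. \<exists>L. has_deriv_on {x..y} f c L"
      using d by (metis atLeastAtMost_iff greaterThanLessThan_iff less_imp_le)
    ultimately obtain c where c: "c \<in> {x<..<y}" "has_deriv_on {x..y} f c ((f y - f x) / (y - x))"
      using assms xy(2) unfolding MVT_def by blast
    have "has_deriv_on {x..y} f c 0" using d c(1) by auto
    moreover have "c < y" "{c..y} \<subseteq> {x..y}" using c(1) by auto
    ultimately have "(f y - f x) / (y - x) = 0"
      using c(2) has_deriv_on_unique by blast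
    then show ?thesis using xy(2) by simp
  qed
  obtain m where "a < m" "m < b" using H dense by blast
  have "f x = f m" if "x \<in> {a<..<b}" for x
    using eq[of x m] eq[of m x] that \<open>a < m\<close> \<open>m < b\<close>
    by (metis greaterThanLessThan_iff linorder_neqE)
  then show "\<exists>k. \<forall>x\<in>{a<..<b}. f x = k" by blast
qed

text \<open>The Mean Value Theorem yields some derivative at an interior point; since derivatives there
  are unique, it is the prescribed one.\<close>

lemma MVT_antiderivative:
  assumes "MVT TYPE('a::linordered_field)" and F: "antiderivative_on a b F f"
    and xy: "a \<le> x" "x < y" "y \<le> (b::'a)"
  obtains c where "c \<in> {a..b}" "F y - F x = f c * (y - x)"
proof -
  have sub: "{x..y} \<subseteq> {a..b}" using xy by auto
  have d: "has_deriv_on {x..y} F c (f c)" if "c \<in> {x..y}" for c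
    using F sub that has_deriv_on_subset unfolding antiderivative_on_def by blast
  then have "cont_on {x..y} F" using has_deriv_on_imp_cont by blast
  moreover have "\<forall>c\<in>{x<..<y}. \<exists>L. has_deriv_on {x..y} F c L"
    using d by (metis atLeastAtMost_iff greaterThanLessThan_iff less_imp_le)
  ultimately obtain c where c: "c \<in> {x<..<y}" "has_deriv_on {x..y} F c ((F y - F x) / (y - x))"
    using assms(1) xy(2) unfolding MVT_def by blast
  have "has_deriv_on {x..y} F c (f c)" using d c(1) by auto
  moreover have "c < y" "{c..y} \<subseteq> {x..y}" using c(1) by auto
  ultimately have "(F y - F x) / (y - x) = f c"
    using c(2) has_deriv_on_unique by blast
  then have "F y - F x = f c * (y - x)" using xy(2) by (simp add: divide_eq_eq)
  moreover have "c \<in> {a..b}" using c(1) xy by simp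
  ultimately show ?thesis using that by blast
qed

lemma MVT_imp_IAT:
  assumes "MVT TYPE('a::linordered_field)"
  shows "IAT TYPE('a)"
  unfolding IAT_def
proof (intro allI impI)
  fix a b :: 'a and f F
  assume H: "a \<le> b \<and> cont_on {a..b} f \<and> (\<forall>x\<in>{a..b}. 0 \<le> f x) \<and> antiderivative_on a b F f"
  show "mono_on {a..b} F"
  proof (rule mono_onI)
    fix x y assume xy: "x \<in> {a..b}" "y \<in> {a..b}" "x \<le> y"
    show "F x \<le> F y"
    proof (cases "x = y")
      case False
      then obtain c where c: "c \<in> {a..b}" "F y - F x = f c * (y - x)"
        using MVT_antiderivative[OF assms, of a b F f x y] H xy by auto
      have "0 \<le> f c * (y - x)" using H c(1) xy(3) by (intro mult_nonneg_nonneg) auto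
      then show ?thesis using c(2) by simp
    qed simp
  qed
qed

lemma MVT_imp_ADT:
  assumes "MVT TYPE('a::linordered_field)"
  shows "ADT TYPE('a)"
  unfolding ADT_def
proof (intro allI impI)
  fix a b :: 'a and f F G
  assume H: "a \<le> b \<and> cont_on {a..b} f \<and> antiderivative_on a b F f \<and> antiderivative_on a b G f"
  have "antiderivative_on a b (\<lambda>x. F x - G x) (\<lambda>x. 0)"
    unfolding antiderivative_on_def
  proof
    fix c assume "c \<in> {a..b}"
    then have "has_deriv_on {a..b} F c (f c)" "has_deriv_on {a..b} G c (f c)"
      using H unfolding antiderivative_on_def by auto
    from has_deriv_on_diff[OF this] show "has_deriv_on {a..b} (\<lambda>x. F x - G x) c 0" by simp
  qed
  then have "F x - G x = F a - G a" if "x \<in> {a..b}" for x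
    using that MVT_antiderivative[OF assms, of a b "\<lambda>x. F x - G x" "\<lambda>x. 0" a x]
    by (cases "x = a") force+
  then show "\<exists>k. \<forall>x\<in>{a..b}. F x - G x = k" by blast
qed

section \<open>Jumps refute the differential principles\<close>

text \<open>The jump across a gap is an antiderivative of zero with different values at the two ends of
  an interval around the gap, hence it contradicts each principle that derives the behaviour of a
  function from its derivative.\<close>

lemma MVT_imp_complete:
  assumes "MVT TYPE('a::linordered_field)"
  shows "dedekind_complete TYPE('a)"
proof (rule ccontr)
  assume "\<not> ?thesis"
  then obtain A :: "'a set" where A: "gap A" using not_complete_imp_gap by blast
  obtain a b where ab: "a \<in> A" "b \<notin> A" "a < b" using gap_endpoints[OF A] .
  obtain c where "jump A b - jump A a = 0 * (b - a)"
    using MVT_antiderivative[OF assms jump_antiderivative[OF A, of a b], of a b] ab by auto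
  then show False using ab by (simp add: jump_def)
qed

lemma IAT_imp_complete:
  assumes "IAT TYPE('a::linordered_field)"
  shows "dedekind_complete TYPE('a)"
proof (rule ccontr)
  assume "\<not> ?thesis"
  then obtain A :: "'a set" where A: "gap A" using not_complete_imp_gap by blast
  obtain a b where ab: "a \<in> A" "b \<notin> A" "a < b" using gap_endpoints[OF A] .
  \<comment> \<open>The jump itself is increasing, so its negative is needed here.\<close>
  have "antiderivative_on a b (\<lambda>x. 0 - jump A x) (\<lambda>x. 0)"
    using jump_antiderivative[OF A] has_deriv_on_diff[of "{a..b}" "\<lambda>x. 0" _ 0 "jump A" 0]
      const_antiderivative[of a b 0]
    unfolding antiderivative_on_def by force
  then have "mono_on {a..b} (\<lambda>x. 0 - jump A x)"
    using assms ab(3) cont_on_const[of "{a..b}" 0] unfolding IAT_def by (metis order_less_imp_le order_refl)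
  then have "0 - jump A a \<le> 0 - jump A b" 
    using mono_onD[of "{a..b}" "\<lambda>x. 0 - jump A x" a b] ab(3) by auto
  then show False using ab by (simp add: jump_def)
qed

lemma ADT_imp_complete:
  assumes "ADT TYPE('a::linordered_field)"
  shows "dedekind_complete TYPE('a)"
proof (rule ccontr)
  assume "\<not> ?thesis"
  then obtain A :: "'a set" where A: "gap A" using not_complete_imp_gap by blast
  obtain a b where ab: "a \<in> A" "b \<notin> A" "a < b" using gap_endpoints[OF A] .
  obtain k where "\<forall>x\<in>{a..b}. jump A x - 0 = k"
    using assms ab(3) cont_on_const[of "{a..b}" 0] jump_antiderivative[OF A, of a b]
      const_antiderivative[of a b 0]
    unfolding ADT_def by (metis order_less_imp_le)
  then have "jump A a = jump A b" using ab(3) by auto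
  then show False using ab by (simp add: jump_def)
qed

lemma CVT_imp_complete:
  assumes "CVT TYPE('a::linordered_field)"
  shows "dedekind_complete TYPE('a)"
proof (rule ccontr)
  assume "\<not> ?thesis"
  then obtain A :: "'a set" where A: "gap A" using not_complete_imp_gap by blast
  obtain a b where ab: "a \<in> A" "b \<notin> A" "a < b" using gap_endpoints[OF A] .
  \<comment> \<open>A larger interval, so that the points on both sides of the gap are interior.\<close>
  have "\<forall>c\<in>{a - 1<..<b + 1}. has_deriv_on {a - 1<..<b + 1} (jump A) c 0"
    using locally_constant_imp_deriv[OF jump_locally_constant[OF A]] by blast
  moreover have "a - 1 < b + 1"
    using ab(3) less_trans[of "a - 1" a b] less_trans[of "a - 1" b "b + 1"] by simp
  ultimately obtain k where "\<forall>x\<in>{a - 1<..<b + 1}. jump A x = k"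
    using assms unfolding CVT_def by blast
  moreover have "a \<in> {a - 1<..<b + 1}" "b \<in> {a - 1<..<b + 1}"
    using ab(3) less_trans[of "a - 1" a b] less_trans[of "a - 1" a "b + 1"]
      less_trans[of a b "b + 1"] less_trans[of "a - 1" a b] by simp_all
  ultimately have "jump A a = jump A b" by metis
  then show False using ab by (simp add: jump_def)
qed

section \<open>Unbounded continuous functions in incomplete fields\<close>

text \<open>Running maxima of an enumeration are monotone and still exceed every element.\<close>

lemma CC_imp_mono_sequence:
  assumes "CC TYPE('a::linordered_field)"
  obtains N :: "nat \<Rightarrow> 'a::linordered_field" where "mono N" "\<And>x. \<exists>n. x < N n"
proof -
  obtain S :: "'a set" where S: "countable S" "infinite S" "cofinal_set S"
    using assms unfolding CC_def by blast
  define g where "g = from_nat_into S"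
  have rg: "range g = S" unfolding g_def using S by (metis finite.emptyI range_from_nat_into)
  define N where "N n = Max (g ` {..n})" for n
  have "mono N" unfolding N_def mono_def by (auto intro!: Max_mono)
  moreover have "\<exists>n. x < N n" for x
  proof -
    obtain n where "x < g n" using S(3) rg unfolding cofinal_set_def by blast
    also have "g n \<le> N n" unfolding N_def by simp
    finally show ?thesis by blast
  qed
  ultimately show ?thesis using that by blast
qed

text \<open>Send a point of \<open>A\<close> to the \<open>k\<close>-th term of the cofinal sequence, where \<open>k\<close> is the least index
  with the point in \<open>D k\<close>, and all points outside \<open>A\<close> to zero. Near each point only finitely many
  gaps matter, and membership in each is locally constant, so this function is locally constant. It
  is unbounded, because gaps are linearly ordered by inclusion: the union of finitely many of the
  \<open>D k\<close> is one of them and so leaves points of \<open>A\<close> that are sent to later terms.\<close>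

lemma gap_exhaustion_imp_not_BVT:
  fixes A :: "'a::linordered_field set" and N :: "nat \<Rightarrow> 'a"
  assumes N: "mono N" "\<And>x::'a. \<exists>n. x < N n"
    and A: "gap A" and D: "\<And>k::nat. gap (D k)" "\<And>k. D k \<subset> A" "(\<Union>k. D k) = A"
  shows "\<not> BVT TYPE('a)"
proof
  assume bvt: "BVT TYPE('a)"
  define f where "f x = (if x \<in> A then N (LEAST k. x \<in> D k) else 0)" for x
  have loc: "locally_constant_on X f" for X
    unfolding locally_constant_on_def
  proof
    fix c
    obtain \<delta>0 where \<delta>0: "\<delta>0 > 0" "\<And>y. \<bar>y - c\<bar> < \<delta>0 \<Longrightarrow> y \<in> A \<longleftrightarrow> c \<in> A"
      using gap_member_locally_constant[OF A] by metis
    have "\<exists>\<delta>>0. \<forall>j\<le>n. \<forall>y. \<bar>y - c\<bar> < \<delta> \<longrightarrow> (y \<in> D j \<longleftrightarrow> c \<in> D j)" for n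
    proof (induction n)
      case 0
      then show ?case using gap_member_locally_constant[OF D(1)[of 0], of c] by simp
    next
      case (Suc n)
      then obtain d where d: "d > 0" "\<forall>j\<le>n. \<forall>y. \<bar>y - c\<bar> < d \<longrightarrow> (y \<in> D j \<longleftrightarrow> c \<in> D j)" by blast
      obtain e where e: "e > 0" "\<forall>y. \<bar>y - c\<bar> < e \<longrightarrow> (y \<in> D (Suc n) \<longleftrightarrow> c \<in> D (Suc n))"
        using gap_member_locally_constant[OF D(1)[of "Suc n"], of c] by blast
      have "y \<in> D j \<longleftrightarrow> c \<in> D j" if "j \<le> Suc n" "\<bar>y - c\<bar> < min d e" for j y
      proof (cases "j = Suc n")
        case True
        then show ?thesis using e(2) that(2) by simp
      next
        case False
        then show ?thesis using d(2) that by simp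
      qed
      moreover have "min d e > 0" using d(1) e(1) by simp
      ultimately show ?case by blast
    qed
    then obtain \<delta>1 where \<delta>1: "\<delta>1 > 0"
      "\<And>j y. j \<le> (LEAST k. c \<in> D k) \<Longrightarrow> \<bar>y - c\<bar> < \<delta>1 \<Longrightarrow> y \<in> D j \<longleftrightarrow> c \<in> D j"
      by metis
    have "f y = f c" if y: "\<bar>y - c\<bar> < min \<delta>0 \<delta>1" for y
    proof (cases "c \<in> A")
      case True
      then have "\<exists>k. c \<in> D k" using D(3) by blast
      then have ck: "c \<in> D (LEAST k. c \<in> D k)" by (rule LeastI_ex)
      have "(LEAST k. y \<in> D k) = (LEAST k. c \<in> D k)"
      proof (rule Least_equality)
        show "y \<in> D (LEAST k. c \<in> D k)" using \<delta>1(2)[OF order_refl, of y] ck y by simp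
        fix j assume "y \<in> D j"
        show "(LEAST k. c \<in> D k) \<le> j"
        proof (rule ccontr)
          assume nle: "\<not> ?thesis"
          then have "c \<in> D j" using \<delta>1(2)[of j y] y \<open>y \<in> D j\<close> by simp
          then show False using Least_le[of "\<lambda>k. c \<in> D k" j] nle by blast
        qed
      qed
      then show ?thesis using True \<delta>0(2)[of y] y unfolding f_def by simp
    next
      case False
      then show ?thesis using \<delta>0(2)[of y] y unfolding f_def by simp
    qed
    moreover have "min \<delta>0 \<delta>1 > 0" using \<delta>0(1) \<delta>1(1) by simp
    ultimately show "\<exists>\<delta>>0. \<forall>x\<in>X. \<bar>x - c\<bar> < \<delta> \<longrightarrow> f x = f c" by blast
  qed
  obtain a where a: "a \<in> D 0" using D(1) unfolding gap_def by blast
  obtain b where b: "b \<notin> A" using A unfolding gap_def by blast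
  have "a < b" using gap_less[OF A] a b D(2) by blast
  then obtain M where M: "\<And>x. x \<in> {a..b} \<Longrightarrow> f x \<le> M"
    using bvt locally_constant_imp_cont[OF loc] unfolding BVT_def by (metis order_less_imp_le)
  obtain n where n: "M < N n" using N(2) by blast
  have "\<exists>x\<in>A. \<forall>j\<le>n. x \<notin> D j" for n
  proof (induction n)
    case 0
    then show ?case using D(2)[of 0] by auto
  next
    case (Suc n)
    then obtain x where x: "x \<in> A" "\<forall>j\<le>n. x \<notin> D j" by blast
    obtain y where y: "y \<in> A" "y \<notin> D (Suc n)" using D(2)[of "Suc n"] by blast
    have "max x y \<in> A" using x(1) y(1) by (simp add: max_def)
    moreover have "max x y \<notin> D j" if "j \<le> Suc n" for j
    proof (cases "j = Suc n")
      case True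
      then show ?thesis using y(2) D(1)[of j] max.cobounded2[of y x] unfolding gap_def by blast
    next
      case False
      then have "x \<notin> D j" using x(2) that by simp
      then show ?thesis using D(1)[of j] max.cobounded1[of x y] unfolding gap_def by blast
    qed
    ultimately show ?case by blast
  qed
  then obtain x where x: "x \<in> A" "\<forall>j\<le>n. x \<notin> D j" by blast
  have "x \<in> D (LEAST k. x \<in> D k)" using x(1) D(3) by (metis LeastI_ex UN_iff)
  then have "n \<le> (LEAST k. x \<in> D k)" using x(2) by (metis nle_le)
  then have "N n \<le> f x" using N(1) x(1) unfolding f_def mono_def by simp
  moreover have "a < x" "x < b" using gap_less[OF D(1)[of 0], of a x] gap_less[OF A, of x b] a b x by auto
  ultimately show False using M[of x] n by auto
qed

text \<open>A gap need not be approached by a sequence, so in general only some gap can be exhausted. In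
  an Archimedean field every gap works: shifted down by \<open>1 / (k + 1)\<close> it becomes strictly smaller,
  and these shifts exhaust it. A field with an element \<open>\<omega>\<close> above all natural numbers has its own
  gap, since the natural numbers have upper bounds but no least one; it is exhausted by the cuts
  that the points \<open>k + n / \<omega>\<close> for varying \<open>n\<close> define, which lie infinitesimally above \<open>k\<close>.\<close>

lemma CC_BVT_imp_complete:
  assumes "CC TYPE('a::linordered_field)" "BVT TYPE('a)"
  shows "dedekind_complete TYPE('a)"
proof (rule ccontr)
  assume "\<not> ?thesis"
  then obtain A :: "'a set" where A: "gap A" using not_complete_imp_gap by blast
  obtain N :: "nat \<Rightarrow> 'a" where N: "mono N" "\<And>x. \<exists>n. x < N n"
    using CC_imp_mono_sequence[OF assms(1)] by blast
  show False
  proof (cases "\<forall>x::'a. \<exists>n. x < of_nat n")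
    case True
    define t :: "nat \<Rightarrow> 'a" where "t k = inverse (of_nat (Suc k))" for k
    have t: "t k > 0" for k unfolding t_def by (simp only: inverse_positive_iff_positive of_nat_0_less_iff)
    have small: "\<exists>k. t k < e" if "e > 0" for e
    proof -
      obtain n where "inverse e < of_nat n" using True by blast
      then have "inverse e < of_nat (Suc n)" by (rule less_trans) simp
      then have "t n < e" unfolding t_def using that by (metis inverse_inverse_eq inverse_less_iff_less inverse_positive_iff_positive less_trans)
      then show ?thesis by blast
    qed
    define D where "D k = {x. x + t k \<in> A}" for k
    have shift: "y - t k \<in> D k \<longleftrightarrow> y \<in> A" for y k unfolding D_def by simp
    have gapD: "gap (D k)" for k
      unfolding gap_def
    proof (intro conjI ballI allI impI)
      obtain y where "y \<in> A" using A unfolding gap_def by blast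
      then show "D k \<noteq> {}" using shift by blast
      obtain z where "z \<notin> A" using A unfolding gap_def by blast
      then show "D k \<noteq> UNIV" using shift by blast
      show "y \<in> D k" if "x \<in> D k" "y \<le> x" for x y
        using that A unfolding D_def gap_def by (metis add_le_cancel_right mem_Collect_eq)
      fix x assume "x \<in> D k"
      then obtain y where "y \<in> A" "x + t k < y" using A unfolding D_def gap_def by blast
      then show "\<exists>y\<in>D k. x < y" using shift[of y k] by (intro bexI[of _ "y - t k"]) (auto simp: algebra_simps)
    next
      fix x assume "x \<notin> D k"
      then obtain y where "y \<notin> A" "y < x + t k" using A unfolding D_def gap_def by blast
      then show "\<exists>y. y \<notin> D k \<and> y < x" using shift[of y k] by (intro exI[of _ "y - t k"]) (auto simp: algebra_simps)
    qed
    have sub: "D k \<subseteq> A" for k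
      using A t[of k] unfolding D_def gap_def by (metis (no_types, lifting) le_add_same_cancel1 less_imp_le mem_Collect_eq subsetI)
    have "D k \<noteq> A" for k
    proof
      assume "D k = A"
      \<comment> \<open>A gap stable under a positive shift contains an unbounded progression.\<close>
      then have step: "x + t k \<in> A" if "x \<in> A" for x using that unfolding D_def by blast
      obtain a b where ab: "a \<in> A" "b \<notin> A" "a < b" using gap_endpoints[OF A] .
      have "a + of_nat n * t k \<in> A" for n
      proof (induction n)
        case (Suc n)
        then show ?case using step[OF Suc] by (simp add: algebra_simps)
      qed (use ab(1) in simp)
      then have "of_nat n < (b - a) / t k" for n
        using gap_less[OF A _ ab(2), of "a + of_nat n * t k"] t[of k] by (simp add: pos_less_divide_eq algebra_simps)
      then show False using True by (meson less_asym)
    qed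
    moreover have "(\<Union>k. D k) = A"
    proof
      show "A \<subseteq> (\<Union>k. D k)"
      proof
        fix x assume "x \<in> A"
        then obtain y where y: "y \<in> A" "x < y" using A unfolding gap_def by blast
        obtain k where "t k < y - x" using small[of "y - x"] y by auto
        then have "x + t k \<le> y" by (simp add: algebra_simps)
        then have "x \<in> D k" using A y(1) unfolding D_def gap_def by blast
        then show "x \<in> (\<Union>k. D k)" by blast
      qed
    qed (use sub in blast)
    ultimately have "\<not> BVT TYPE('a)"
      by (intro gap_exhaustion_imp_not_BVT[OF N A gapD] psubsetI sub)
    then show False using assms(2) by blast
  next
    case False
    then obtain \<omega> :: 'a where w: "\<And>n. of_nat n \<le> \<omega>" by (auto simp: not_less)
    have w0: "\<omega> > 0" using w[of 1] by (metis less_le_trans of_nat_1 zero_less_one)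
    have w1: "of_nat n / \<omega> < 1" for n
      using w[of "Suc n"] w0 less_le_trans[OF less_add_one[of "of_nat n"]]
      by (simp add: pos_divide_less_eq add.commute)
    define A' :: "'a set" where "A' = {x. \<exists>n. x < of_nat n}"
    define D :: "nat \<Rightarrow> 'a set" where "D k = {x. \<exists>n. x < of_nat k + of_nat n / \<omega>}" for k
    have gapA: "gap A'"
      unfolding gap_def
    proof (intro conjI ballI allI impI)
      have "(0::'a) < of_nat 1" by simp
      then have "0 \<in> A'" unfolding A'_def by blast
      then show "A' \<noteq> {}" by blast
      have "\<omega> \<notin> A'" unfolding A'_def using w by (simp add: not_less)
      then show "A' \<noteq> UNIV" by blast
      show "y \<in> A'" if "x \<in> A'" "y \<le> x" for x y using that unfolding A'_def using le_less_trans by blast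
      show "\<exists>y\<in>A'. x < y" if "x \<in> A'" for x
        using that dense[of x "of_nat _"] unfolding A'_def by blast
      fix x assume x: "x \<notin> A'"
      have "x - 1 \<notin> A'"
      proof
        assume "x - 1 \<in> A'"
        then obtain n where "x - 1 < of_nat n" unfolding A'_def by blast
        then have "x < of_nat (Suc n)" by (simp add: algebra_simps)
        then show False using x unfolding A'_def by blast
      qed
      then show "\<exists>y. y \<notin> A' \<and> y < x" by (intro exI[of _ "x - 1"]) simp
    qed
    have gapD: "gap (D k)" for k
      unfolding gap_def
    proof (intro conjI ballI allI impI)
      have "of_nat k - 1 \<in> D k" unfolding D_def by (auto intro!: exI[of _ 0])
      then show "D k \<noteq> {}" by blast
      have "of_nat k + 1 \<notin> D k" unfolding D_def using w1 by (simp add: not_less less_imp_le)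
      then show "D k \<noteq> UNIV" by blast
      show "y \<in> D k" if "x \<in> D k" "y \<le> x" for x y using that unfolding D_def using le_less_trans by blast
      show "\<exists>y\<in>D k. x < y" if "x \<in> D k" for x
        using that dense[of x "of_nat k + _"] unfolding D_def by blast
      fix x assume x: "x \<notin> D k"
      have "x - 1 / \<omega> \<notin> D k"
      proof
        assume "x - 1 / \<omega> \<in> D k"
        then obtain n where "x - 1 / \<omega> < of_nat k + of_nat n / \<omega>" unfolding D_def by blast
        then have "x < of_nat k + of_nat (Suc n) / \<omega>" by (simp add: algebra_simps add_divide_distrib)
        then show False using x unfolding D_def by blast
      qed
      then show "\<exists>y. y \<notin> D k \<and> y < x" using w0 by (intro exI[of _ "x - 1 / \<omega>"]) simp
    qed
    have "D k \<subset> A'" for k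
    proof
      show "D k \<subseteq> A'"
      proof
        fix x assume "x \<in> D k"
        then obtain n where "x < of_nat k + of_nat n / \<omega>" unfolding D_def by blast
        also have "\<dots> < of_nat (Suc k)" using w1[of n] by simp
        finally show "x \<in> A'" unfolding A'_def by blast
      qed
      have "of_nat k + 1 \<notin> D k" unfolding D_def using w1 by (simp add: not_less less_imp_le)
      moreover have "of_nat k + 1 \<in> A'" unfolding A'_def by (auto intro!: exI[of _ "Suc (Suc k)"])
      ultimately show "D k \<noteq> A'" by blast
    qed
    moreover have "(\<Union>k. D k) = A'"
    proof
      show "(\<Union>k. D k) \<subseteq> A'" using \<open>\<And>k. D k \<subset> A'\<close> by blast
      show "A' \<subseteq> (\<Union>k. D k)"
      proof
        fix x assume "x \<in> A'"
        then obtain n where "x < of_nat n" unfolding A'_def by blast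
        then have "x \<in> D n" unfolding D_def by (auto intro!: exI[of _ 0])
        then show "x \<in> (\<Union>k. D k)" by blast
      qed
    qed
    ultimately have "\<not> BVT TYPE('a)"
      by (intro gap_exhaustion_imp_not_BVT[OF N gapA gapD])
    then show False using assms(2) by blast
  qed
qed

section \<open>Interval induction\<close>

text \<open>This takes the place of the compactness of \<open>[a, b]\<close>. Let \<open>s\<close> be the supremum of the points
  that are reachable from \<open>a\<close>. The small intervals around \<open>s\<close> join a reachable point just below \<open>s\<close>
  to \<open>s\<close> and to points beyond it, so \<open>s = b\<close>.\<close>

lemma interval_induction:
  assumes C: "dedekind_complete TYPE('a::linordered_field)" and ab: "a \<le> (b::'a)"
    and join: "\<And>u v w. a \<le> u \<Longrightarrow> u \<le> v \<Longrightarrow> v \<le> w \<Longrightarrow> w \<le> b \<Longrightarrow> P u v \<Longrightarrow> P v w \<Longrightarrow> P u w"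
    and local: "\<And>c. c \<in> {a..b} \<Longrightarrow> \<exists>\<delta>>0. \<forall>u v. a \<le> u \<and> u \<le> c \<and> c \<le> v \<and> v \<le> b \<and>
      c - u < \<delta> \<and> v - c < \<delta> \<longrightarrow> P u v"
  shows "P a b"
proof -
  define S where "S = {x \<in> {a..b}. P a x}"
  have "a \<in> S" unfolding S_def using local[of a] ab by auto
  moreover have "\<forall>x\<in>S. x \<le> b" unfolding S_def by simp
  ultimately obtain s where s: "isLub UNIV S s"
    using C unfolding dedekind_complete_def by blast
  have sab: "a \<le> s" "s \<le> b"
    using s \<open>a \<in> S\<close> \<open>\<forall>x\<in>S. x \<le> b\<close> unfolding isLub_iff by auto
  obtain \<delta> where \<delta>: "\<delta> > 0"
    "\<And>u v. a \<le> u \<Longrightarrow> u \<le> s \<Longrightarrow> s \<le> v \<Longrightarrow> v \<le> b \<Longrightarrow> s - u < \<delta> \<Longrightarrow> v - s < \<delta> \<Longrightarrow> P u v"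
    using local[of s] sab by auto
  have "\<not> s \<le> s - \<delta>" using \<delta>(1) by simp
  then obtain x where x: "x \<in> S" "s - \<delta> < x" using s unfolding isLub_iff by (meson not_less)
  have xs: "x \<le> s" using x(1) s unfolding isLub_iff by blast
  have reach: "v \<le> s" if "s \<le> v" "v \<le> b" "v - s < \<delta>" for v
  proof -
    have "P x v" using \<delta>(2)[of x v] that x xs unfolding S_def by (auto simp: algebra_simps)
    then have "P a v" using join[of a x v] that x(1) xs unfolding S_def by auto
    then have "v \<in> S" using that sab unfolding S_def by auto
    then show ?thesis using s unfolding isLub_iff by blast
  qed
  have "s = b"
  proof (rule ccontr)
    assume "s \<noteq> b"
    then have "s < b" using sab by simp
    then obtain v where "s < v" "v < b" "\<bar>v - s\<bar> < \<delta>"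
      using interval_point_right_near \<delta>(1) by blast
    then show False using reach[of v] by auto
  qed
  have "P x b" using \<delta>(2)[of x b] x xs \<delta>(1) sab \<open>s = b\<close> unfolding S_def by (auto simp: algebra_simps)
  then show ?thesis using join[of a x b] x(1) xs \<open>s = b\<close> unfolding S_def by auto
qed

text \<open>If no value were maximal, each value would be exceeded near each point by a single value,
  hence by interval induction all values on \<open>[a, b]\<close> would be exceeded by one of them.\<close>

lemma continuous_attains_max:
  assumes C: "dedekind_complete TYPE('a::linordered_field)" and ab: "a \<le> (b::'a)"
    and f: "cont_on {a..b} f"
  shows "\<exists>y\<in>{a..b}. \<forall>x\<in>{a..b}. f x \<le> f y"
proof (rule ccontr)
  assume "\<not> ?thesis"
  then have up: "\<exists>y\<in>{a..b}. f x < f y" if "x \<in> {a..b}" for x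
    using that by (meson not_le)
  have "\<exists>y\<in>{a..b}. \<forall>t\<in>{a..b}. f t < f y"
  proof (rule interval_induction[OF C ab, where P = "\<lambda>u v. \<exists>y\<in>{a..b}. \<forall>t\<in>{u..v}. f t < f y"])
    fix u v w :: 'a
    assume "\<exists>y\<in>{a..b}. \<forall>t\<in>{u..v}. f t < f y" "\<exists>y\<in>{a..b}. \<forall>t\<in>{v..w}. f t < f y"
    then obtain y z where y: "y \<in> {a..b}" "\<forall>t\<in>{u..v}. f t < f y"
      and z: "z \<in> {a..b}" "\<forall>t\<in>{v..w}. f t < f z" by blast
    define m where "m = (if f y \<le> f z then z else y)"
    have "f y \<le> f m" "f z \<le> f m" "m \<in> {a..b}" using y(1) z(1) unfolding m_def by auto
    moreover have "f t < f y \<or> f t < f z" if "t \<in> {u..w}" for t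
      using that y(2) z(2) by (cases "t \<le> v") auto
    ultimately have "\<forall>t\<in>{u..w}. f t < f m" by (meson less_le_trans)
    then show "\<exists>y\<in>{a..b}. \<forall>t\<in>{u..w}. f t < f y" using \<open>m \<in> {a..b}\<close> by blast
  next
    fix c assume c: "c \<in> {a..b}"
    then obtain y where y: "y \<in> {a..b}" "f c < f y" using up by blast
    then have "f y - f c > 0" by simp
    then obtain \<delta> where \<delta>: "\<delta> > 0" "\<And>x. x \<in> {a..b} \<Longrightarrow> \<bar>x - c\<bar> < \<delta> \<Longrightarrow> \<bar>f x - f c\<bar> < f y - f c"
      using f c unfolding cont_on_def by metis
    have "f t < f y" if "a \<le> u" "u \<le> c" "c \<le> v" "v \<le> b" "c - u < \<delta>" "v - c < \<delta>" "t \<in> {u..v}" for u v t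
    proof -
      have "t - c \<le> v - c" "c - t \<le> c - u" using that(7) by auto
      then have "\<bar>t - c\<bar> < \<delta>" using that(5,6) by (auto simp: abs_if intro: le_less_trans)
      then show ?thesis using \<delta>(2)[of t] that by (auto simp: abs_less_iff)
    qed
    then show "\<exists>\<delta>>0. \<forall>u v. a \<le> u \<and> u \<le> c \<and> c \<le> v \<and> v \<le> b \<and> c - u < \<delta> \<and> v - c < \<delta> \<longrightarrow>
        (\<exists>y\<in>{a..b}. \<forall>t\<in>{u..v}. f t < f y)"
      using \<delta>(1) y(1) by blast
  qed
  then show False by auto
qed

lemma complete_imp_BVT:
  "dedekind_complete TYPE('a::linordered_field) \<Longrightarrow> BVT TYPE('a)"
  unfolding BVT_def using continuous_attains_max by blast

lemma complete_imp_CC: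
  assumes "dedekind_complete TYPE('a::linordered_field)"
  shows "CC TYPE('a)"
proof -
  have "cofinal_set (range (of_nat :: nat \<Rightarrow> 'a))"
  proof (rule ccontr)
    assume "\<not> ?thesis"
    then have "\<exists>u. \<forall>x\<in>range (of_nat :: nat \<Rightarrow> 'a). x \<le> u"
      unfolding cofinal_set_def by (meson not_less)
    then obtain s where s: "isLub UNIV (range (of_nat :: nat \<Rightarrow> 'a)) s"
      using assms unfolding dedekind_complete_def by blast
    have "of_nat n \<le> s - 1" for n
    proof -
      have "of_nat (Suc n) \<le> s" using s unfolding isLub_iff by blast
      then show ?thesis by (simp add: algebra_simps)
    qed
    then have "s \<le> s - 1" using s unfolding isLub_iff by blast
    then show False by simp
  qed
  moreover have "infinite (range (of_nat :: nat \<Rightarrow> 'a))"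
    by (intro range_inj_infinite inj_of_nat)
  moreover have "countable (range (of_nat :: nat \<Rightarrow> 'a))" by simp
  ultimately show ?thesis unfolding CC_def by (intro exI conjI)
qed

section \<open>The Mean Value Theorem\<close>

text \<open>If the derivative differed from \<open>q\<close>, then on one side of \<open>c\<close> the graph of \<open>f\<close> would rise above
  the line of slope \<open>q\<close> through \<open>(c, f c)\<close>.\<close>

lemma deriv_at_interior_max:
  assumes d: "has_deriv_on {a..b} f c L" and c: "a < c" "c < (b::'a::linordered_field)"
    and m: "\<And>x. x \<in> {a..b} \<Longrightarrow> f x - q * x \<le> f c - q * c"
  shows "L = q"
proof (rule ccontr)
  assume "L \<noteq> q"
  then have "\<bar>L - q\<bar> > 0" by simp
  then obtain \<delta> where \<delta>: "\<delta> > 0" "\<And>x. x \<in> {a..b} \<Longrightarrow> 0 < \<bar>x - c\<bar> \<Longrightarrow> \<bar>x - c\<bar> < \<delta> \<Longrightarrow>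
      \<bar>(f x - f c) / (x - c) - L\<bar> < \<bar>L - q\<bar>"
    using d unfolding has_deriv_on_def by metis
  show False
  proof (cases "L > q")
    case True
    obtain x where x: "c < x" "x < b" "\<bar>x - c\<bar> < \<delta>" using interval_point_right_near c(2) \<delta>(1) by blast
    then have "\<bar>(f x - f c) / (x - c) - L\<bar> < L - q" using \<delta>(2)[of x] c True by auto
    then have "q < (f x - f c) / (x - c)" by (auto simp: abs_less_iff)
    then have "q * (x - c) < f x - f c" using x(1) by (simp add: pos_less_divide_eq)
    then show False using m[of x] x c by (simp add: algebra_simps)
  next
    case False
    obtain x where x: "a < x" "x < c" "\<bar>x - c\<bar> < \<delta>" using interval_point_left_near c(1) \<delta>(1) by blast
    then have "\<bar>(f x - f c) / (x - c) - L\<bar> < q - L" using \<delta>(2)[of x] c False by auto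
    then have "(f x - f c) / (x - c) < q" by (auto simp: abs_less_iff)
    then have "q * (x - c) < f x - f c" using x(2) by (simp add: neg_divide_less_eq)
    then show False using m[of x] x c by (simp add: algebra_simps)
  qed
qed

lemma cont_on_add_linear:
  assumes "cont_on X f"
  shows "cont_on X (\<lambda>x. f x + q * x)"
  unfolding cont_on_def
proof (intro ballI allI impI)
  fix c \<epsilon> :: 'a assume c: "c \<in> X" and \<epsilon>: "\<epsilon> > 0"
  have e2: "\<epsilon> / 2 > 0" using \<epsilon> by simp
  obtain d where d: "d > 0" "\<And>x. x \<in> X \<Longrightarrow> \<bar>x - c\<bar> < d \<Longrightarrow> \<bar>f x - f c\<bar> < \<epsilon> / 2"
    using assms c e2 unfolding cont_on_def by metis
  define K where "K = \<bar>q\<bar> + 1"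
  have K: "K > 0" "\<bar>q\<bar> \<le> K" unfolding K_def by (simp_all add: add_nonneg_pos)
  show "\<exists>\<delta>>0. \<forall>x\<in>X. \<bar>x - c\<bar> < \<delta> \<longrightarrow> \<bar>f x + q * x - (f c + q * c)\<bar> < \<epsilon>"
  proof (intro exI[of _ "min d (\<epsilon> / 2 / K)"] conjI ballI impI)
    show "min d (\<epsilon> / 2 / K) > 0" using d(1) e2 K by simp
    fix x assume x: "x \<in> X" "\<bar>x - c\<bar> < min d (\<epsilon> / 2 / K)"
    have "\<bar>q * (x - c)\<bar> \<le> K * \<bar>x - c\<bar>" using K(2) by (simp add: abs_mult mult_right_mono)
    also have "\<dots> < \<epsilon> / 2"
    proof -
      have "\<bar>x - c\<bar> < \<epsilon> / 2 / K" using x(2) by simp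
      then show ?thesis using K(1) by (simp only: pos_less_divide_eq mult.commute)
    qed
    finally have "\<bar>q * (x - c)\<bar> < \<epsilon> / 2" .
    moreover have "\<bar>f x - f c\<bar> < \<epsilon> / 2" using d(2) x by simp
    ultimately have "\<bar>f x - f c\<bar> + \<bar>q * (x - c)\<bar> < \<epsilon> / 2 + \<epsilon> / 2" by (intro add_strict_mono)
    moreover have "f x + q * x - (f c + q * c) = (f x - f c) + q * (x - c)" by (simp add: algebra_simps)
    ultimately show "\<bar>f x + q * x - (f c + q * c)\<bar> < \<epsilon>"
      using abs_triangle_ineq[of "f x - f c" "q * (x - c)"] by simp
  qed
qed

lemma cont_on_uminus: "cont_on X f \<Longrightarrow> cont_on X (\<lambda>x. - f x)"
  unfolding cont_on_def by (simp add: abs_minus_commute)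

lemma has_deriv_on_uminus:
  assumes "has_deriv_on X f c L"
  shows "has_deriv_on X (\<lambda>x. - f x) c (- L)"
proof -
  have "has_deriv_on X (\<lambda>x. 0) c 0" unfolding has_deriv_on_def by (auto intro: exI[of _ 1])
  from has_deriv_on_diff[OF this assms] show ?thesis by simp
qed

text \<open>After subtraction of the chord, the function takes equal values at both endpoints, so its
  maximum or its minimum is attained at an interior point.\<close>

lemma complete_imp_MVT:
  assumes C: "dedekind_complete TYPE('a::linordered_field)"
  shows "MVT TYPE('a)"
  unfolding MVT_def
proof (intro allI impI)
  fix a b :: 'a and f
  assume H: "a < b \<and> cont_on {a..b} f \<and> (\<forall>c\<in>{a<..<b}. \<exists>L. has_deriv_on {a..b} f c L)"
  define q where "q = (f b - f a) / (b - a)"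
  have q: "f b - q * b = f a - q * a"
  proof -
    have "q * (b - a) = f b - f a" using H unfolding q_def by simp
    then show ?thesis by (simp add: algebra_simps)
  qed
  have "cont_on {a..b} (\<lambda>x. f x + (- q) * x)" using H cont_on_add_linear by blast
  then have ch: "cont_on {a..b} (\<lambda>x. f x - q * x)" by simp
  have ab: "a \<le> b" using H by simp
  obtain y where y: "y \<in> {a..b}" "\<And>x. x \<in> {a..b} \<Longrightarrow> f x - q * x \<le> f y - q * y"
    using continuous_attains_max[OF C ab ch] by blast
  obtain z where z: "z \<in> {a..b}" "\<And>x. x \<in> {a..b} \<Longrightarrow> f z - q * z \<le> f x - q * x"
    using continuous_attains_max[OF C ab cont_on_uminus[OF ch]] unfolding neg_le_iff_le by blast
  have int: "c \<in> {a<..<b}" if "c \<in> {a..b}" "c \<noteq> a" "c \<noteq> b" for c using that by auto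
  have "\<exists>c\<in>{a<..<b}. (\<forall>x\<in>{a..b}. f x - q * x \<le> f c - q * c) \<or> (\<forall>x\<in>{a..b}. f c - q * c \<le> f x - q * x)"
  proof (cases "y \<in> {a, b} \<and> z \<in> {a, b}")
    case True
    obtain m where m: "a < m" "m < b" using H dense by blast
    have "f y - q * y = f z - q * z" using True q by auto
    then have "f x - q * x \<le> f m - q * m" if "x \<in> {a..b}" for x
      using y(2)[OF that] z(2)[of m] m by auto
    moreover have "m \<in> {a<..<b}" using m by simp
    ultimately show ?thesis by blast
  next
    case False
    then show ?thesis using y z int by blast
  qed
  then obtain c where c: "c \<in> {a<..<b}"
    "(\<forall>x\<in>{a..b}. f x - q * x \<le> f c - q * c) \<or> (\<forall>x\<in>{a..b}. f c - q * c \<le> f x - q * x)" by blast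
  obtain L where L: "has_deriv_on {a..b} f c L" using H c(1) by blast
  have cab: "a < c" "c < b" using c(1) by auto
  from c(2) have "L = q"
  proof
    assume "\<forall>x\<in>{a..b}. f x - q * x \<le> f c - q * c"
    then show ?thesis using deriv_at_interior_max[OF L cab] by blast
  next
    assume "\<forall>x\<in>{a..b}. f c - q * c \<le> f x - q * x"
    then have "- L = - q"
      by (intro deriv_at_interior_max[OF has_deriv_on_uminus[OF L] cab]) (simp add: algebra_simps)
    then show ?thesis by simp
  qed
  then show "\<exists>c\<in>{a<..<b}. has_deriv_on {a..b} f c ((f b - f a) / (b - a))"
    using L c(1) unfolding q_def by blast
qed

section \<open>Sums over the cells of a partition\<close>

text \<open>A cell of a partition is a pair of successive points. The summand depends on the endpoints of
  the cell and not on its index, so the sums behave well when partitions are refined or joined.\<close>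

definition cell_sum :: "('a \<Rightarrow> 'a \<Rightarrow> 'a) \<Rightarrow> 'a::linordered_field set \<Rightarrow> 'a" where
  "cell_sum g P = (\<Sum>k=1..card P - 1. g (part_pt P (k - 1)) (part_pt P k))"

lemma partition_insert:
  "a < p \<Longrightarrow> is_partition p b P \<Longrightarrow> is_partition a b (insert a P)"
  unfolding is_partition_def by force

lemma partition_le: "is_partition a b P \<Longrightarrow> a \<le> b"
  unfolding is_partition_def by auto

text \<open>A partition is built from its last point by prepending smaller points. Induction along this
  construction avoids sorted lists in most of the proofs about cells.\<close>

lemma partition_induct [consumes 1, case_names single insert]:
  assumes "is_partition a b P"
    and "\<And>b. Q b b {b}"
    and "\<And>a p b P. a < p \<Longrightarrow> is_partition p b P \<Longrightarrow> Q p b P \<Longrightarrow> Q a b (insert a P)"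
  shows "Q a (b::'a::linordered_field) P"
  using assms(1)
proof (induction "card P" arbitrary: a P rule: less_induct)
  case less
  then have P: "finite P" "P \<subseteq> {a..b}" "a \<in> P" "b \<in> P" unfolding is_partition_def by auto
  show ?case
  proof (cases "P = {a}")
    case True
    then show ?thesis using P assms(2)[of b] by simp
  next
    case False
    define p where "p = Min (P - {a})"
    have ne: "P - {a} \<noteq> {}" using False P(3) by auto
    have p: "p \<in> P" "p \<noteq> a" "\<And>x. x \<in> P - {a} \<Longrightarrow> p \<le> x"
      unfolding p_def using Min_in[of "P - {a}"] ne P(1) by auto
    have "a < p" using p(1,2) P(2) by force
    moreover have "is_partition p b (P - {a})"
      unfolding is_partition_def using P p \<open>a < p\<close> by force
    moreover have "card (P - {a}) < card P" using P card_Diff1_less by metis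
    ultimately have "Q a b (insert a (P - {a}))" using assms(3) less.hyps by blast
    then show ?thesis using P(3) by (simp add: insert_absorb)
  qed
qed

lemma sorted_list_partition_insert:
  assumes "a < p" "is_partition p b P"
  shows "sorted_list_of_set (insert a P) = a # sorted_list_of_set P"
proof -
  have P: "finite P" "\<And>x. x \<in> P \<Longrightarrow> a < x" using assms unfolding is_partition_def by auto
  have "sorted_wrt (<) (a # sorted_list_of_set P)" using P by simp
  then show ?thesis
    using sorted_list_of_set.idem_if_sorted_distinct[of "a # sorted_list_of_set P"] P(1)
    unfolding strict_sorted_iff by simp
qed

lemma part_pt_insert:
  assumes "a < p" "is_partition p b P"
  shows "part_pt (insert a P) 0 = a" "part_pt (insert a P) (Suc k) = part_pt P k"
    "card (insert a P) = Suc (card P)" "card P > 0"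
proof -
  show "part_pt (insert a P) 0 = a" "part_pt (insert a P) (Suc k) = part_pt P k"
    unfolding part_pt_def sorted_list_partition_insert[OF assms] by simp_all
  have "finite P" "p \<in> P" "a \<notin> P" using assms unfolding is_partition_def by auto
  then show "card (insert a P) = Suc (card P)" "card P > 0" by (auto simp: card_gt_0_iff)
qed

lemma part_pt_first:
  assumes "is_partition a b P"
  shows "part_pt P 0 = a"
  using assms
proof (induction rule: partition_induct)
  case (single b)
  then show ?case by (simp add: part_pt_def)
next
  case (insert a p b P)
  then show ?case using part_pt_insert(1) by blast
qed

lemma part_pt_in:
  assumes "is_partition a b P" "k < card P"
  shows "part_pt P k \<in> P"
  using assms unfolding part_pt_def is_partition_def
  by (metis nth_mem sorted_list_of_set.length_sorted_key_list_of_set sorted_list_of_set.set_sorted_key_list_of_set)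

lemma part_pt_strict:
  assumes "is_partition a b P" "k \<in> {1..card P - 1}"
  shows "part_pt P (k - 1) < part_pt P k"
  using assms sorted_wrt_nth_less[of "(<)" "sorted_list_of_set P" "k - 1" k]
  unfolding part_pt_def is_partition_def by auto

text \<open>The constants of a step function and the tags of a Riemann sum are numbered; counting the
  partition points below \<open>x\<close> recovers the number of the cell from the point \<open>x\<close>.\<close>

lemma cell_of_point:
  assumes "is_partition a b P" "x \<in> {a..b}" "x \<notin> P"
  shows "card {p\<in>P. p < x} \<in> {1..card P - 1} \<and>
    x \<in> {part_pt P (card {p\<in>P. p < x} - 1)<..<part_pt P (card {p\<in>P. p < x})}"
  using assms
proof (induction arbitrary: rule: partition_induct)
  case (insert a p b P)
  have fin: "finite P" and Pp: "P \<subseteq> {p..b}" using insert.hyps unfolding is_partition_def by auto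
  have "a \<notin> P" using insert.hyps unfolding is_partition_def by auto
  have ax: "a < x" using insert.prems by auto
  then have "{q \<in> insert a P. q < x} = insert a {q\<in>P. q < x}" by auto
  then have card: "card {q \<in> insert a P. q < x} = Suc (card {q\<in>P. q < x})"
    using fin \<open>a \<notin> P\<close> by simp
  show ?case
  proof (cases "x < p")
    case True
    then have "{q\<in>P. q < x} = {}" using Pp by auto
    then have "card {q \<in> insert a P. q < x} = 1" unfolding card by (simp only: card.empty One_nat_def)
    then show ?thesis
      using True ax part_pt_insert[OF insert.hyps(1,2)] part_pt_insert(2)[OF insert.hyps(1,2), of 0]
        part_pt_first[OF insert.hyps(2)]
      by (simp add: Suc_le_eq)
  next
    case False
    then have IH: "card {p\<in>P. p < x} \<in> {1..card P - 1}"
      "x \<in> {part_pt P (card {p\<in>P. p < x} - 1)<..<part_pt P (card {p\<in>P. p < x})}"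
      using insert.IH insert.prems by auto
    then obtain k where k: "card {q\<in>P. q < x} = Suc k" by (cases "card {q\<in>P. q < x}") auto
    show ?thesis using IH part_pt_insert[OF insert.hyps(1,2)] unfolding card k by auto
  qed
qed auto

lemma point_of_cell:
  assumes "is_partition a b P" "k \<in> {1..card P - 1}" "part_pt P (k - 1) < x" "x < part_pt P k"
  shows "x \<notin> P \<and> x \<in> {a..b} \<and> card {p\<in>P. p < x} = k"
  using assms
proof (induction arbitrary: k rule: partition_induct)
  case (insert a p b P)
  have fin: "finite P" and Pp: "P \<subseteq> {p..b}" "p \<in> P" using insert.hyps unfolding is_partition_def by auto
  have "a \<notin> P" using insert.hyps unfolding is_partition_def by auto
  note pt = part_pt_insert[OF insert.hyps(1,2)]
  obtain j where j: "k = Suc j" using insert.prems(1) by (cases k) auto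
  have ax: "a < x \<and> x \<notin> P \<and> x \<le> b \<and> card {q\<in>P. q < x} = j"
  proof (cases j)
    case 0
    then have x: "a < x" "x < p" using insert.prems pt part_pt_first[OF insert.hyps(2)] j by auto
    then have e: "{q\<in>P. q < x} = {}" "x \<notin> P" using Pp by auto
    have "card {q\<in>P. q < x} = j" unfolding e(1) 0 by simp
    then show ?thesis using x e(2) partition_le[OF insert.hyps(2)] by simp
  next
    case (Suc i)
    then have "j \<in> {1..card P - 1}" "part_pt P (j - 1) < x" "x < part_pt P j"
      using insert.prems pt j by auto
    then show ?thesis using insert.IH insert.hyps(1) by force
  qed
  then have "{q \<in> insert a P. q < x} = insert a {q\<in>P. q < x}" by auto
  then have "card {q \<in> insert a P. q < x} = k" using ax fin \<open>a \<notin> P\<close> j by simp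
  then show ?case using ax by auto
qed auto

lemma cell_sum_single [simp]: "cell_sum g {b} = 0"
  unfolding cell_sum_def by simp

lemma cell_sum_insert_first:
  assumes "a < p" "is_partition p b P"
  shows "cell_sum g (insert a P) = g a p + cell_sum g P"
proof -
  note pt = part_pt_insert[OF assms]
  obtain n where n: "card P = Suc n" using pt(4) by (cases "card P") auto
  show ?thesis
    unfolding cell_sum_def One_nat_def sum.atLeast1_atMost_eq pt n diff_Suc_Suc diff_zero
      sum.lessThan_Suc_shift
    by (simp add: pt part_pt_first[OF assms(2)])
qed

lemma cell_sum_mono:
  assumes "is_partition a b P"
    and "\<And>u v. a \<le> u \<Longrightarrow> u < v \<Longrightarrow> v \<le> b \<Longrightarrow> g u v \<le> h u v"
  shows "cell_sum g P \<le> cell_sum h P"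
  using assms
proof (induction rule: partition_induct)
  case (insert a p b P)
  have "g a p \<le> h a p" using insert.prems insert.hyps(1) partition_le[OF insert.hyps(2)] by simp
  moreover have "cell_sum g P \<le> cell_sum h P" using insert.IH insert.prems insert.hyps(1) by simp
  ultimately show ?case by (simp add: cell_sum_insert_first[OF insert.hyps(1,2)] add_mono)
qed simp

lemma cell_sum_telescope:
  assumes "is_partition a b P"
  shows "cell_sum (\<lambda>u v. k * (v - u)) P = k * (b - a)"
  using assms
  by (induction rule: partition_induct) (simp_all add: cell_sum_insert_first algebra_simps)

lemma partition_union:
  "is_partition a b P \<Longrightarrow> is_partition b c Q \<Longrightarrow> is_partition a c (P \<union> Q)"
  unfolding is_partition_def by force

lemma partition_refine:
  "is_partition a b P \<Longrightarrow> finite R \<Longrightarrow> R \<subseteq> {a..b} \<Longrightarrow> is_partition a b (P \<union> R)"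
  unfolding is_partition_def by auto

lemma cell_sum_join:
  assumes "is_partition a b P" "is_partition b c Q"
  shows "cell_sum g (P \<union> Q) = cell_sum g P + cell_sum g Q"
  using assms
proof (induction rule: partition_induct)
  case (single b)
  then have "{b} \<union> Q = Q" unfolding is_partition_def by auto
  then show ?case by simp
next
  case (insert a p b P)
  then show ?case
    using cell_sum_insert_first[OF insert.hyps(1) partition_union[OF insert.hyps(2) insert.prems], of g]
    by (simp add: cell_sum_insert_first add.assoc)
qed

text \<open>A cell function need only be additive when the new point splits an interval without partition
  points: the only cell that changes is the one that contains the new point.\<close>

lemma cell_sum_insert:
  assumes "is_partition a b P" "x \<in> {a..b}"
    and "\<And>u v. a \<le> u \<Longrightarrow> u < x \<Longrightarrow> x < v \<Longrightarrow> v \<le> b \<Longrightarrow> {u<..<v} \<inter> P = {} \<Longrightarrow> g u v = g u x + g x v"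
  shows "cell_sum g (insert x P) = cell_sum g P"
  using assms
proof (induction rule: partition_induct)
  case (insert a p b P)
  have pb: "P \<subseteq> {p..b}" "p \<in> P" "p \<le> b" using insert.hyps unfolding is_partition_def by auto
  consider "x = a" | "a < x" "x < p" | "p \<le> x"
    using insert.prems(1) by (metis atLeastAtMost_iff le_less not_le)
  then show ?case
  proof cases
    case 2
    have P': "is_partition x b (insert x P)" using partition_insert[OF 2(2) insert.hyps(2)] .
    have "{a<..<p} \<inter> insert a P = {}" using pb by auto
    then have "g a p = g a x + g x p" using insert.prems(2)[of a p] 2 pb(3) by simp
    moreover have "insert x (insert a P) = insert a (insert x P)" by auto
    ultimately show ?thesis
      using cell_sum_insert_first[OF 2(1) P', of g] cell_sum_insert_first[OF 2(2) insert.hyps(2), of g]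
        cell_sum_insert_first[OF insert.hyps(1,2), of g]
      by simp
  next
    case 3
    then have xb: "x \<in> {p..b}" using insert.prems(1) by simp
    have P': "is_partition p b (insert x P)"
      using insert.hyps(2) xb unfolding is_partition_def by auto
    have "cell_sum g (insert x P) = cell_sum g P"
    proof (rule insert.IH[OF xb])
      fix u v assume uv: "p \<le> u" "u < x" "x < v" "v \<le> b" "{u<..<v} \<inter> P = {}"
      moreover have "{u<..<v} \<inter> insert a P = {}" using uv(1,5) insert.hyps(1) by auto
      ultimately show "g u v = g u x + g x v" using insert.prems(2)[of u v] insert.hyps(1) by simp
    qed
    moreover have "insert x (insert a P) = insert a (insert x P)" by auto
    ultimately show ?thesis
      using cell_sum_insert_first[OF insert.hyps(1) P', of g] cell_sum_insert_first[OF insert.hyps(1,2), of g]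
      by simp
  qed simp
qed simp

lemma cell_sum_refine:
  assumes P: "is_partition a b P" and R: "finite R" "R \<subseteq> {a..b}"
    and add: "\<And>u x v. a \<le> u \<Longrightarrow> u < x \<Longrightarrow> x < v \<Longrightarrow> v \<le> b \<Longrightarrow> {u<..<v} \<inter> P = {} \<Longrightarrow>
      g u v = g u x + g x v"
  shows "cell_sum g (P \<union> R) = cell_sum g P"
  using R
proof (induction R rule: finite_induct)
  case (insert x R)
  have "is_partition a b (P \<union> R)" using partition_refine[OF P] insert by simp
  then have "cell_sum g (insert x (P \<union> R)) = cell_sum g (P \<union> R)"
  proof (rule cell_sum_insert)
    show "x \<in> {a..b}" using insert.prems by simp
    fix u v assume "a \<le> u" "u < x" "x < v" "v \<le> b" "{u<..<v} \<inter> (P \<union> R) = {}"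
    then show "g u v = g u x + g x v" using add[of u x v] by blast
  qed
  then show ?case using insert by simp
qed simp

section \<open>Integrals of step functions\<close>

lemma step_function_constant:
  assumes "step_on a b P c \<phi>" and xy: "a \<le> x" "x \<le> y" "y \<le> b" "{x..y} \<inter> P = {}"
  shows "\<phi> x = \<phi> y"
proof -
  have P: "is_partition a b P"
    and val: "\<And>k x. k \<in> {1..card P - 1} \<Longrightarrow> x \<in> {part_pt P (k - 1)<..<part_pt P k} \<Longrightarrow> \<phi> x = c k"
    using assms(1) unfolding step_on_def by auto
  have "\<phi> z = c (card {p\<in>P. p < z})" if "z \<in> {a..b}" "z \<notin> P" for z
    using cell_of_point[OF P that] val by blast
  moreover have "x \<in> {a..b}" "x \<notin> P" "y \<in> {a..b}" "y \<notin> P" using xy by auto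
  ultimately have "\<phi> x = c (card {p\<in>P. p < x})" "\<phi> y = c (card {p\<in>P. p < y})" by blast+
  moreover have "p < x \<longleftrightarrow> p < y" if "p \<in> P" for p
    using xy(2,4) that by (metis IntI atLeastAtMost_iff empty_iff less_le_trans not_le less_imp_le)
  then have "{p\<in>P. p < x} = {p\<in>P. p < y}" by blast
  ultimately show ?thesis by simp
qed

lemma midpoint_between:
  "(u::'a::linordered_field) < v \<Longrightarrow> u < (u + v) / 2 \<and> (u + v) / 2 < v"
  by (simp add: field_simps)

text \<open>Reading off the constant values at midpoints makes the sum a function of \<open>\<phi>\<close> and the partition
  alone, free of the indexed constants.\<close>

lemma step_sum_eq_cell_sum:
  assumes "step_on a b P c \<phi>"
  shows "(\<Sum>k=1..card P - 1. c k * (part_pt P k - part_pt P (k - 1))) =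
    cell_sum (\<lambda>u v. \<phi> ((u + v) / 2) * (v - u)) P"
  unfolding cell_sum_def
proof (rule sum.cong[OF refl])
  fix k assume k: "k \<in> {1..card P - 1}"
  have "part_pt P (k - 1) < part_pt P k"
    using part_pt_strict assms k unfolding step_on_def by blast
  then have "\<phi> ((part_pt P (k - 1) + part_pt P k) / 2) = c k"
    using assms k midpoint_between unfolding step_on_def by (metis greaterThanLessThan_iff)
  then show "c k * (part_pt P k - part_pt P (k - 1)) =
      \<phi> ((part_pt P (k - 1) + part_pt P k) / 2) * (part_pt P k - part_pt P (k - 1))" by simp
qed

lemma step_cell_additive:
  assumes "step_on a b P c \<phi>" and "a \<le> u" "u < x" "x < v" "v \<le> b" "{u<..<v} \<inter> P = {}"
  shows "\<phi> ((u + v) / 2) * (v - u) = \<phi> ((u + x) / 2) * (x - u) + \<phi> ((x + v) / 2) * (v - x)"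
proof -
  have m: "u < (u + x) / 2" "(u + x) / 2 < x" "x < (x + v) / 2" "(x + v) / 2 < v"
    using midpoint_between assms(3,4) by blast+
  have eq: "\<phi> y = \<phi> x" if "u < y" "y < v" for y
  proof (cases "y \<le> x")
    case True
    moreover have "{y..x} \<subseteq> {u<..<v}" using that(1) assms(4) by auto
    then have "{y..x} \<inter> P = {}" using assms(6) by blast
    ultimately show ?thesis using step_function_constant[OF assms(1), of y x] that assms by simp
  next
    case False
    moreover have "{x..y} \<subseteq> {u<..<v}" using that(2) assms(3) by auto
    then have "{x..y} \<inter> P = {}" using assms(6) by blast
    ultimately show ?thesis using step_function_constant[OF assms(1), of x y] that assms by simp
  qed
  have "u < v" using assms(3,4) by simp
  then have "\<phi> ((u + v) / 2) = \<phi> x" using eq midpoint_between by blast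
  moreover have "\<phi> ((u + x) / 2) = \<phi> x" "\<phi> ((x + v) / 2) = \<phi> x"
    using eq[OF m(1) less_trans[OF m(2) assms(4)]] eq[OF less_trans[OF assms(3) m(3)] m(4)] .
  ultimately show ?thesis by (simp add: algebra_simps)
qed

text \<open>Passing to a common refinement leaves both sums unchanged and allows a comparison cell by
  cell. For two representations of one function, comparison in both directions shows that the
  integral is well defined.\<close>

lemma step_sum_mono:
  assumes \<phi>: "step_on a b P c \<phi>" and \<psi>: "step_on a b Q d \<psi>"
    and le: "\<And>x. x \<in> {a..b} \<Longrightarrow> \<phi> x \<le> \<psi> x"
  shows "(\<Sum>k=1..card P - 1. c k * (part_pt P k - part_pt P (k - 1))) \<le>
    (\<Sum>k=1..card Q - 1. d k * (part_pt Q k - part_pt Q (k - 1)))"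
proof -
  define g where "g u v = \<phi> ((u + v) / 2) * (v - u)" for u v
  define h where "h u v = \<psi> ((u + v) / 2) * (v - u)" for u v
  have P: "is_partition a b P" and Q: "is_partition a b Q"
    using \<phi> \<psi> unfolding step_on_def by auto
  then have fin: "finite P" "P \<subseteq> {a..b}" "finite Q" "Q \<subseteq> {a..b}" unfolding is_partition_def by auto
  have "cell_sum g P = cell_sum g (P \<union> Q)"
    unfolding g_def using step_cell_additive[OF \<phi>] by (intro cell_sum_refine[OF P fin(3,4), symmetric]) blast
  also have "\<dots> \<le> cell_sum h (P \<union> Q)"
  proof (rule cell_sum_mono[OF partition_refine[OF P fin(3,4)]])
    fix u v assume uv: "a \<le> u" "u < v" "v \<le> b"
    then have "(u + v) / 2 \<in> {a..b}" using midpoint_between[OF uv(2)] by auto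
    then show "g u v \<le> h u v" unfolding g_def h_def using le uv(2) by (intro mult_right_mono) auto
  qed
  also have "P \<union> Q = Q \<union> P" by blast
  also have "cell_sum h (Q \<union> P) = cell_sum h Q"
    unfolding h_def using step_cell_additive[OF \<psi>] by (intro cell_sum_refine[OF Q fin(1,2)]) blast
  finally show ?thesis
    unfolding g_def h_def step_sum_eq_cell_sum[OF \<phi>] step_sum_eq_cell_sum[OF \<psi>] .
qed

lemma step_integral_eq:
  assumes "step_on a b P c \<phi>"
  shows "step_integral a b \<phi> = (\<Sum>k=1..card P - 1. c k * (part_pt P k - part_pt P (k - 1)))"
  unfolding step_integral_def
proof (rule the_equality)
  show "\<exists>Q d. step_on a b Q d \<phi> \<and>
      (\<Sum>k=1..card P - 1. c k * (part_pt P k - part_pt P (k - 1))) =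
      (\<Sum>k=1..card Q - 1. d k * (part_pt Q k - part_pt Q (k - 1)))" using assms by blast
  fix s assume "\<exists>Q d. step_on a b Q d \<phi> \<and>
      s = (\<Sum>k=1..card Q - 1. d k * (part_pt Q k - part_pt Q (k - 1)))"
  then obtain Q d where st: "step_on a b Q d \<phi>"
    and s: "s = (\<Sum>k=1..card Q - 1. d k * (part_pt Q k - part_pt Q (k - 1)))" by blast
  show "s = (\<Sum>k=1..card P - 1. c k * (part_pt P k - part_pt P (k - 1)))"
    unfolding s
    by (intro antisym step_sum_mono[OF assms st order_refl] step_sum_mono[OF st assms order_refl])
qed

lemma step_integral_mono:
  assumes "step_function a b \<phi>" "step_function a b \<psi>" "\<And>x. x \<in> {a..b} \<Longrightarrow> \<phi> x \<le> \<psi> x"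
  shows "step_integral a b \<phi> \<le> step_integral a b \<psi>"
proof -
  obtain P c Q d where st: "step_on a b P c \<phi>" "step_on a b Q d \<psi>"
    using assms(1,2) unfolding step_function_def by blast
  show ?thesis
    unfolding step_integral_eq[OF st(1)] step_integral_eq[OF st(2)]
    using step_sum_mono[OF st assms(3)] .
qed

lemma step_function_shift:
  assumes "step_function a b \<phi>"
  shows "step_function a b (\<lambda>x. \<phi> x + k)"
    "step_integral a b (\<lambda>x. \<phi> x + k) = step_integral a b \<phi> + k * (b - a)"
proof -
  obtain P c where st: "step_on a b P c \<phi>" using assms unfolding step_function_def by blast
  then have st': "step_on a b P (\<lambda>i. c i + k) (\<lambda>x. \<phi> x + k)" unfolding step_on_def by simp
  then show "step_function a b (\<lambda>x. \<phi> x + k)" unfolding step_function_def by blast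
  have "(\<Sum>i=1..card P - 1. k * (part_pt P i - part_pt P (i - 1))) = k * (b - a)"
    using cell_sum_telescope[of a b P k] st unfolding step_on_def cell_sum_def by simp
  then show "step_integral a b (\<lambda>x. \<phi> x + k) = step_integral a b \<phi> + k * (b - a)"
    unfolding step_integral_eq[OF st] step_integral_eq[OF st'] by (simp add: distrib_right sum.distrib)
qed

lemma step_function_bounded:
  assumes "step_function a b \<phi>"
  shows "\<exists>M. \<forall>x\<in>{a..b}. M \<le> \<phi> x"
proof -
  obtain P c where st: "step_on a b P c \<phi>" using assms unfolding step_function_def by blast
  then have P: "is_partition a b P" unfolding step_on_def by blast
  define V where "V = \<phi> ` P \<union> c ` {1..card P - 1}"
  have fin: "finite V" using P unfolding V_def is_partition_def by simp
  have "\<phi> x \<in> V" if "x \<in> {a..b}" for x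
  proof (cases "x \<in> P")
    case False
    then show ?thesis
      using cell_of_point[OF P that] st unfolding V_def step_on_def by blast
  qed (simp add: V_def)
  then have "\<forall>x\<in>{a..b}. Min V \<le> \<phi> x" using fin by simp
  then show ?thesis by blast
qed

section \<open>Completeness from approximation and integration by step functions\<close>

text \<open>A least upper bound of the empty set would be a least element, so an existing lower integral
  forces a step function below \<open>f\<close>; this bounds \<open>f\<close> from below.\<close>

lemma DIT_imp_BVT:
  assumes "DIT TYPE('a::linordered_field)"
  shows "BVT TYPE('a)"
  unfolding BVT_def
proof (intro allI impI)
  fix a b :: 'a and f assume H: "a \<le> b \<and> cont_on {a..b} f"
  then obtain I where I: "has_lower_integral a b (\<lambda>x. - f x) I"
    using assms cont_on_uminus unfolding DIT_def by blast
  have "lower_step_integrals a b (\<lambda>x. - f x) \<noteq> {}"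
  proof
    assume "lower_step_integrals a b (\<lambda>x. - f x) = {}"
    then have "I \<le> I - 1" using I unfolding has_lower_integral_def isLub_iff by blast
    then show False by simp
  qed
  then obtain \<phi> where \<phi>: "step_function a b \<phi>" "\<forall>x\<in>{a..b}. \<phi> x \<le> - f x"
    unfolding lower_step_integrals_def by blast
  obtain M where "\<forall>x\<in>{a..b}. M \<le> \<phi> x" using step_function_bounded[OF \<phi>(1)] by blast
  then have "\<forall>x\<in>{a..b}. f x \<le> - M" using \<phi>(2) by (metis le_minus_iff order_trans)
  then show "\<exists>M. \<forall>x\<in>{a..b}. f x \<le> M" by blast
qed

lemma RIT_imp_DIT: "RIT TYPE('a::linordered_field) \<Longrightarrow> DIT TYPE('a)"
  unfolding RIT_def DIT_def riemann_integrable_def by blast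

text \<open>A step function is constant on an interval that meets both sides of a gap, since a finite
  partition leaves room next to the gap on either side; so it cannot be close to the jump there.\<close>

lemma UAS_imp_complete:
  assumes "UAS TYPE('a::linordered_field)"
  shows "dedekind_complete TYPE('a)"
proof (rule ccontr)
  assume "\<not> ?thesis"
  then obtain A :: "'a set" where A: "gap A" using not_complete_imp_gap by blast
  obtain a b where ab: "a \<in> A" "b \<notin> A" "a < b" using gap_endpoints[OF A] .
  have "cont_on {a..b} (jump A)"
    using locally_constant_imp_cont[OF jump_locally_constant[OF A]] .
  moreover have "(1::'a) / 2 > 0" by simp
  ultimately obtain \<phi> where \<phi>: "step_function a b \<phi>" "\<And>x. x \<in> {a..b} \<Longrightarrow> \<bar>jump A x - \<phi> x\<bar> < 1 / 2"
    using assms ab(3) unfolding UAS_def by (metis order_less_imp_le)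
  obtain P c where st: "step_on a b P c \<phi>" using \<phi>(1) unfolding step_function_def by blast
  then have P: "finite P" "P \<subseteq> {a..b}" "a \<in> P" "b \<in> P" unfolding step_on_def is_partition_def by auto
  define u where "u = Max (P \<inter> A)"
  define v where "v = Min (P - A)"
  have "u \<in> P \<inter> A" unfolding u_def using P ab(1) by (intro Max_in) auto
  moreover have "v \<in> P - A" unfolding v_def using P ab(2) by (intro Min_in) auto
  ultimately obtain x y where x: "x \<in> A" "u < x" and y: "y \<notin> A" "y < v"
    using A unfolding gap_def by blast
  have xy: "x < y" "a < x" "y < b"
  proof -
    show "x < y" using gap_less[OF A x(1) y(1)] .
    have "a \<le> u" using \<open>u \<in> P \<inter> A\<close> P(2) by auto
    then show "a < x" using x(2) by simp
    have "v \<le> b" using \<open>v \<in> P - A\<close> P(2) by auto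
    then show "y < b" using y(2) by simp
  qed
  have "{x..y} \<inter> P = {}"
  proof (rule ccontr)
    assume "{x..y} \<inter> P \<noteq> {}"
    then obtain p where p: "p \<in> P" "x \<le> p" "p \<le> y" by auto
    show False
    proof (cases "p \<in> A")
      case True
      then have "p \<le> u" unfolding u_def using P(1) p(1) by simp
      then show False using p(2) x(2) by simp
    next
      case False
      then have "v \<le> p" unfolding v_def using P(1) p(1) by simp
      then show False using p(3) y(2) by simp
    qed
  qed
  then have "\<phi> x = \<phi> y" using step_function_constant[OF st, of x y] xy by simp
  moreover have "\<bar>0 - \<phi> x\<bar> < 1 / 2" "\<bar>1 - \<phi> y\<bar> < 1 / 2"
    using \<phi>(2)[of x] \<phi>(2)[of y] xy x(1) y(1) by (auto simp: jump_def)
  ultimately show False by (simp add: abs_if field_simps split: if_splits)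
qed

section \<open>Integrals of continuous functions\<close>

definition fine_partition ::
    "('a::linordered_field \<Rightarrow> 'a) \<Rightarrow> 'a \<Rightarrow> 'a \<Rightarrow> 'a \<Rightarrow> 'a set \<Rightarrow> bool" where
  "fine_partition f a b \<epsilon> P \<longleftrightarrow> is_partition a b P \<and>
     (\<forall>x y. a \<le> x \<and> x < y \<and> y \<le> b \<and> {x<..<y} \<inter> P = {} \<longrightarrow> \<bar>f x - f y\<bar> < \<epsilon>)"

text \<open>Stating the oscillation bound for all pairs of points without a partition point strictly
  between them covers the closed cells and is stable under refinement and joining.\<close>

lemma fine_partition_refine:
  "fine_partition f a b \<epsilon> P \<Longrightarrow> is_partition a b Q \<Longrightarrow> P \<subseteq> Q \<Longrightarrow> fine_partition f a b \<epsilon> Q"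
  unfolding fine_partition_def by blast

lemma fine_partition_exists:
  assumes C: "dedekind_complete TYPE('a::linordered_field)" and ab: "a \<le> (b::'a)"
    and f: "cont_on {a..b} f" and \<epsilon>: "\<epsilon> > 0"
  shows "\<exists>P. fine_partition f a b \<epsilon> P"
proof (rule interval_induction[OF C ab, where P = "\<lambda>u v. \<exists>P. fine_partition f u v \<epsilon> P"])
  fix u v w
  assume "\<exists>P. fine_partition f u v \<epsilon> P" "\<exists>P. fine_partition f v w \<epsilon> P"
  then obtain P Q where PQ: "fine_partition f u v \<epsilon> P" "fine_partition f v w \<epsilon> Q" by blast
  then have "v \<in> P" unfolding fine_partition_def is_partition_def by blast
  have "\<bar>f x - f y\<bar> < \<epsilon>" if "u \<le> x" "x < y" "y \<le> w" "{x<..<y} \<inter> (P \<union> Q) = {}" for x y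
  proof (cases "y \<le> v")
    case True
    then show ?thesis using PQ(1) that unfolding fine_partition_def by blast
  next
    case False
    then have "v \<le> x" using that \<open>v \<in> P\<close> by force
    then show ?thesis using PQ(2) that unfolding fine_partition_def by blast
  qed
  then have "fine_partition f u w \<epsilon> (P \<union> Q)"
    using PQ partition_union unfolding fine_partition_def by blast
  then show "\<exists>P. fine_partition f u w \<epsilon> P" by blast
next
  fix c assume c: "c \<in> {a..b}"
  have e2: "\<epsilon> / 2 > 0" using \<epsilon> by simp
  obtain \<delta> where \<delta>: "\<delta> > 0" "\<And>x. x \<in> {a..b} \<Longrightarrow> \<bar>x - c\<bar> < \<delta> \<Longrightarrow> \<bar>f x - f c\<bar> < \<epsilon> / 2"
    using f c e2 unfolding cont_on_def by metis
  have "fine_partition f u v \<epsilon> {u, v}"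
    if uv: "a \<le> u" "u \<le> c" "c \<le> v" "v \<le> b" "c - u < \<delta>" "v - c < \<delta>" for u v
  proof -
    have near: "\<bar>f x - f c\<bar> < \<epsilon> / 2" if "u \<le> x" "x \<le> v" for x
    proof -
      have "x - c \<le> v - c" "c - x \<le> c - u" using that by auto
      then have "\<bar>x - c\<bar> < \<delta>" using uv(5,6) by (auto simp: abs_if intro: le_less_trans)
      then show ?thesis using \<delta>(2)[of x] that uv by simp
    qed
    have "\<bar>f x - f y\<bar> < \<epsilon>" if "u \<le> x" "x < y" "y \<le> v" for x y
    proof -
      have "\<bar>f x - f c\<bar> + \<bar>f c - f y\<bar> < \<epsilon> / 2 + \<epsilon> / 2"
        using near[of x] near[of y] that by (intro add_strict_mono) (auto simp: abs_minus_commute)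
      moreover have "\<bar>f x - f y\<bar> \<le> \<bar>f x - f c\<bar> + \<bar>f c - f y\<bar>"
        using abs_triangle_ineq[of "f x - f c" "f c - f y"] by simp
      ultimately show ?thesis by simp
    qed
    moreover have "is_partition u v {u, v}" using uv unfolding is_partition_def by auto
    ultimately show ?thesis unfolding fine_partition_def by blast
  qed
  then show "\<exists>\<delta>>0. \<forall>u v. a \<le> u \<and> u \<le> c \<and> c \<le> v \<and> v \<le> b \<and> c - u < \<delta> \<and> v - c < \<delta> \<longrightarrow>
      (\<exists>P. fine_partition f u v \<epsilon> P)" using \<delta>(1) by blast
qed

text \<open>Every Riemann sum over a fine partition is the integral of a step function that approximates
  \<open>f\<close>: on a cell it takes the value of \<open>f\<close> at the tag, and on the partition it equals \<open>f\<close>. This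
  reduces Riemann sums to step functions.\<close>

lemma riemann_sum_as_step_integral:
  assumes fine: "fine_partition f a b \<epsilon> P" and tag: "is_tagging P \<xi>" and \<epsilon>: "\<epsilon> > 0"
  obtains \<phi> where "step_function a b \<phi>" "step_integral a b \<phi> = riemann_sum f P \<xi>"
    "\<And>x. x \<in> {a..b} \<Longrightarrow> \<bar>f x - \<phi> x\<bar> < \<epsilon>"
proof -
  have P: "is_partition a b P"
    and osc: "\<And>x y. a \<le> x \<Longrightarrow> x < y \<Longrightarrow> y \<le> b \<Longrightarrow> {x<..<y} \<inter> P = {} \<Longrightarrow> \<bar>f x - f y\<bar> < \<epsilon>"
    using fine unfolding fine_partition_def by auto
  define \<phi> where "\<phi> x = (if x \<in> P then f x else f (\<xi> (card {p\<in>P. p < x})))" for x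
  have st: "step_on a b P (\<lambda>k. f (\<xi> k)) \<phi>"
    unfolding step_on_def \<phi>_def using P point_of_cell[OF P] by auto
  have "step_integral a b \<phi> = riemann_sum f P \<xi>"
    unfolding riemann_sum_def step_integral_eq[OF st] ..
  moreover have "\<bar>f x - \<phi> x\<bar> < \<epsilon>" if x: "x \<in> {a..b}" for x
  proof (cases "x \<in> P")
    case True
    then show ?thesis using \<epsilon> unfolding \<phi>_def by simp
  next
    case False
    define k where "k = card {p\<in>P. p < x}"
    have k: "k \<in> {1..card P - 1}" "part_pt P (k - 1) < x" "x < part_pt P k"
      using cell_of_point[OF P x False] unfolding k_def by auto
    have \<xi>: "part_pt P (k - 1) \<le> \<xi> k" "\<xi> k \<le> part_pt P k"
      using tag k(1) unfolding is_tagging_def by auto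
    have "part_pt P (k - 1) \<in> P" "part_pt P k \<in> P" using part_pt_in[OF P] k(1) by auto
    then have \<xi>ab: "a \<le> \<xi> k" "\<xi> k \<le> b" using P \<xi> unfolding is_partition_def by force+
    have none: "p \<notin> P" if "part_pt P (k - 1) < p" "p < part_pt P k" for p
      using point_of_cell[OF P k(1) that] by blast
    consider "\<xi> k < x" | "\<xi> k = x" | "x < \<xi> k" using less_linear by blast
    then have "\<bar>f x - f (\<xi> k)\<bar> < \<epsilon>"
    proof cases
      case 1
      have "p \<notin> P" if "\<xi> k < p" "p < x" for p
        using none[of p] that \<xi>(1) k(3) by simp
      then have "{\<xi> k<..<x} \<inter> P = {}" by auto
      then show ?thesis using osc[of "\<xi> k" x] 1 \<xi>ab x by (simp add: abs_minus_commute)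
    next
      case 2
      then show ?thesis using \<epsilon> by simp
    next
      case 3
      have "p \<notin> P" if "x < p" "p < \<xi> k" for p
        using none[of p] that \<xi>(2) k(2) by simp
      then have "{x<..<\<xi> k} \<inter> P = {}" by auto
      then show ?thesis using osc[of x "\<xi> k"] 3 \<xi>ab x by simp
    qed
    then show ?thesis using False unfolding \<phi>_def k_def by simp
  qed
  moreover have "step_function a b \<phi>" using st unfolding step_function_def by blast
  ultimately show ?thesis using that by blast
qed

lemma right_endpoint_tagging: "is_partition a b P \<Longrightarrow> is_tagging P (part_pt P)"
  unfolding is_tagging_def using part_pt_strict by (metis atLeastAtMost_iff less_imp_le order_refl)

lemma complete_imp_UAS:
  assumes "dedekind_complete TYPE('a::linordered_field)"
  shows "UAS TYPE('a)"
  unfolding UAS_def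
proof (intro allI impI)
  fix a b :: 'a and f \<epsilon> assume H: "a \<le> b \<and> cont_on {a..b} f" and \<epsilon>: "\<epsilon> > (0::'a)"
  then obtain P where P: "fine_partition f a b \<epsilon> P" using fine_partition_exists[OF assms] by blast
  then have "is_tagging P (part_pt P)" using right_endpoint_tagging unfolding fine_partition_def by blast
  from riemann_sum_as_step_integral[OF P this \<epsilon>]
  show "\<exists>\<phi>. step_function a b \<phi> \<and> (\<forall>x\<in>{a..b}. \<bar>f x - \<phi> x\<bar> < \<epsilon>)" by metis
qed

text \<open>Shifting an approximating step function down and up by \<open>\<epsilon>\<close> gives step functions below and
  above \<open>f\<close>.\<close>

lemma approximation_brackets_lower_integrals:
  assumes \<phi>: "step_function a b \<phi>" "\<And>x. x \<in> {a..b} \<Longrightarrow> \<bar>f x - \<phi> x\<bar> < \<epsilon>"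
  shows "step_integral a b \<phi> - \<epsilon> * (b - a) \<in> lower_step_integrals a b f"
    and "s \<in> lower_step_integrals a b f \<Longrightarrow> s \<le> step_integral a b \<phi> + \<epsilon> * (b - a)"
proof -
  have near: "\<phi> x + - \<epsilon> \<le> f x \<and> f x \<le> \<phi> x + \<epsilon>" if "x \<in> {a..b}" for x
  proof -
    have "f x - \<phi> x < \<epsilon>" "\<phi> x - f x < \<epsilon>" using \<phi>(2)[OF that] by (auto simp: abs_less_iff)
    then have "f x < \<phi> x + \<epsilon>" "\<phi> x < f x + \<epsilon>" by (simp_all add: algebra_simps)
    then show ?thesis by (simp add: algebra_simps)
  qed
  show "step_integral a b \<phi> - \<epsilon> * (b - a) \<in> lower_step_integrals a b f"
    unfolding lower_step_integrals_def mem_Collect_eq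
  proof (intro exI conjI ballI)
    show "step_integral a b \<phi> - \<epsilon> * (b - a) = step_integral a b (\<lambda>x. \<phi> x + - \<epsilon>)"
      unfolding step_function_shift(2)[OF \<phi>(1)] by simp
    show "step_function a b (\<lambda>x. \<phi> x + - \<epsilon>)" using step_function_shift(1)[OF \<phi>(1)] .
    show "\<phi> x + - \<epsilon> \<le> f x" if "x \<in> {a..b}" for x using near[OF that] by blast
  qed
  assume "s \<in> lower_step_integrals a b f"
  then obtain \<psi> where \<psi>: "s = step_integral a b \<psi>" "step_function a b \<psi>" "\<forall>x\<in>{a..b}. \<psi> x \<le> f x"
    unfolding lower_step_integrals_def by blast
  have "s \<le> step_integral a b (\<lambda>x. \<phi> x + \<epsilon>)"
    unfolding \<psi>(1) using \<psi>(3) near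
    by (intro step_integral_mono[OF \<psi>(2) step_function_shift(1)[OF \<phi>(1)]]) (meson order_trans)
  then show "s \<le> step_integral a b \<phi> + \<epsilon> * (b - a)" unfolding step_function_shift(2)[OF \<phi>(1)] .
qed

lemma complete_imp_DIT:
  assumes C: "dedekind_complete TYPE('a::linordered_field)"
  shows "DIT TYPE('a)"
  unfolding DIT_def
proof (intro allI impI)
  fix a b :: 'a and f assume H: "a \<le> b \<and> cont_on {a..b} f"
  then obtain \<phi> where \<phi>: "step_function a b \<phi>" "\<And>x. x \<in> {a..b} \<Longrightarrow> \<bar>f x - \<phi> x\<bar> < 1"
    using complete_imp_UAS[OF C] unfolding UAS_def by (metis zero_less_one)
  note br = approximation_brackets_lower_integrals[of a b \<phi> f 1, OF \<phi>]
  have "lower_step_integrals a b f \<noteq> {}" using br(1) by blast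
  moreover have "\<exists>u. \<forall>s\<in>lower_step_integrals a b f. s \<le> u" using br(2) by blast
  ultimately show "\<exists>I. has_lower_integral a b f I"
    using C unfolding dedekind_complete_def has_lower_integral_def by blast
qed

text \<open>Each Riemann sum over a fine partition is the integral of an approximating step function, so
  the bracket around it contains the supremum of the lower sums.\<close>

lemma lower_integral_is_riemann_integral:
  assumes C: "dedekind_complete TYPE('a::linordered_field)" and ab: "a \<le> (b::'a)"
    and f: "cont_on {a..b} f" and I: "has_lower_integral a b f I"
  shows "has_riemann_integral a b f I"
  unfolding has_riemann_integral_def
proof (intro allI impI)
  fix \<epsilon> :: 'a assume \<epsilon>: "\<epsilon> > 0"
  \<comment> \<open>The summand 1 admits the degenerate interval and makes the final bound strict.\<close>
  define \<eta> where "\<eta> = \<epsilon> / (b - a + 1)"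
  have pos: "b - a + 1 > 0" using ab by (simp add: add_nonneg_pos)
  then have \<eta>: "\<eta> > 0" unfolding \<eta>_def using \<epsilon> by simp
  have "\<eta> * (b - a) < \<eta> * (b - a + 1)" using \<eta> by simp
  also have "\<dots> = \<epsilon>" unfolding \<eta>_def using pos by simp
  finally have small: "\<eta> * (b - a) < \<epsilon>" .
  obtain P where P: "fine_partition f a b \<eta> P" using fine_partition_exists[OF C ab f \<eta>] by blast
  have "riemann_sum f Q \<xi> \<in> {I - \<epsilon><..<I + \<epsilon>}"
    if Q: "is_partition a b Q" "is_tagging Q \<xi>" "P \<subseteq> Q" for Q \<xi>
  proof -
    have "fine_partition f a b \<eta> Q" using fine_partition_refine[OF P Q(1,3)] .
    from riemann_sum_as_step_integral[OF this Q(2) \<eta>]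
    obtain \<phi> where \<phi>: "step_function a b \<phi>" "step_integral a b \<phi> = riemann_sum f Q \<xi>"
      "\<And>x. x \<in> {a..b} \<Longrightarrow> \<bar>f x - \<phi> x\<bar> < \<eta>" by blast
    note br = approximation_brackets_lower_integrals[of a b \<phi> f \<eta>, OF \<phi>(1,3)]
    have "riemann_sum f Q \<xi> - \<eta> * (b - a) \<le> I" "I \<le> riemann_sum f Q \<xi> + \<eta> * (b - a)"
      using br I unfolding \<phi>(2) has_lower_integral_def isLub_iff by blast+
    then have "riemann_sum f Q \<xi> \<le> I + \<eta> * (b - a)" "I - \<eta> * (b - a) \<le> riemann_sum f Q \<xi>"
      by (simp_all add: algebra_simps)
    moreover have "I + \<eta> * (b - a) < I + \<epsilon>" "I - \<epsilon> < I - \<eta> * (b - a)" using small by simp_all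
    ultimately show ?thesis unfolding greaterThanLessThan_iff using le_less_trans less_le_trans by blast
  qed
  then have "riemann_sums_beyond a b f P \<subseteq> {I - \<epsilon><..<I + \<epsilon>}"
    unfolding riemann_sums_beyond_def by blast
  then show "\<exists>\<Delta>. is_partition a b \<Delta> \<and> riemann_sums_beyond a b f \<Delta> \<subseteq> {I - \<epsilon><..<I + \<epsilon>}"
    using P unfolding fine_partition_def by blast
qed

lemma riemann_integral_exists:
  assumes C: "dedekind_complete TYPE('a::linordered_field)" and "a \<le> (b::'a)" "cont_on {a..b} f"
  shows "\<exists>I. has_riemann_integral a b f I"
  using complete_imp_DIT[OF C] lower_integral_is_riemann_integral[OF C] assms(2,3)
  unfolding DIT_def by blast

text \<open>With right endpoints as tags, Riemann sums are cell sums, for which comparison and joining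
  of intervals are available.\<close>

lemma riemann_integral_cell_sums:
  assumes "has_riemann_integral a b f I" "\<epsilon> > 0"
  shows "\<exists>\<Delta>. is_partition a b \<Delta> \<and> (\<forall>P. is_partition a b P \<and> \<Delta> \<subseteq> P \<longrightarrow>
    \<bar>cell_sum (\<lambda>u v. f v * (v - u)) P - I\<bar> < \<epsilon>)"
proof -
  obtain \<Delta> where \<Delta>: "is_partition a b \<Delta>" "riemann_sums_beyond a b f \<Delta> \<subseteq> {I - \<epsilon><..<I + \<epsilon>}"
    using assms unfolding has_riemann_integral_def by blast
  have "\<bar>cell_sum (\<lambda>u v. f v * (v - u)) P - I\<bar> < \<epsilon>" if P: "is_partition a b P" "\<Delta> \<subseteq> P" for P
  proof -
    have "riemann_sum f P (part_pt P) \<in> {I - \<epsilon><..<I + \<epsilon>}"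
      using \<Delta>(2) P right_endpoint_tagging[OF P(1)] unfolding riemann_sums_beyond_def by blast
    moreover have "riemann_sum f P (part_pt P) = cell_sum (\<lambda>u v. f v * (v - u)) P"
      unfolding riemann_sum_def cell_sum_def ..
    ultimately show ?thesis by (simp add: abs_less_iff algebra_simps)
  qed
  then show ?thesis using \<Delta>(1) by blast
qed

lemma abs_eq_0_if_small: "(\<And>\<epsilon>. \<epsilon> > 0 \<Longrightarrow> \<bar>x - y\<bar> < \<epsilon>) \<Longrightarrow> x = (y::'a::linordered_field)"
  by (metis less_irrefl right_minus_eq zero_less_abs_iff)

text \<open>Partitions of the two parts that absorb the points of a partition of the whole interval join
  to a refinement of it.\<close>

lemma riemann_integral_additive:
  assumes "has_riemann_integral a b f I" "has_riemann_integral b c f J" "has_riemann_integral a c f K"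
  shows "K = I + J"
proof (rule abs_eq_0_if_small)
  fix \<epsilon> :: 'a assume "\<epsilon> > 0"
  then have \<epsilon>: "\<epsilon> / 3 > 0" by simp
  define g where "g u v = f v * (v - u)" for u v
  obtain P where P: "is_partition a b P"
    "\<And>R. is_partition a b R \<Longrightarrow> P \<subseteq> R \<Longrightarrow> \<bar>cell_sum g R - I\<bar> < \<epsilon> / 3"
    using riemann_integral_cell_sums[OF assms(1) \<epsilon>] unfolding g_def by blast
  obtain Q where Q: "is_partition b c Q"
    "\<And>R. is_partition b c R \<Longrightarrow> Q \<subseteq> R \<Longrightarrow> \<bar>cell_sum g R - J\<bar> < \<epsilon> / 3"
    using riemann_integral_cell_sums[OF assms(2) \<epsilon>] unfolding g_def by blast
  obtain S where S: "is_partition a c S"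
    "\<And>R. is_partition a c R \<Longrightarrow> S \<subseteq> R \<Longrightarrow> \<bar>cell_sum g R - K\<bar> < \<epsilon> / 3"
    using riemann_integral_cell_sums[OF assms(3) \<epsilon>] unfolding g_def by blast
  define P' where "P' = P \<union> (S \<inter> {a..b})"
  define Q' where "Q' = Q \<union> (S \<inter> {b..c})"
  have finS: "finite S" "S \<subseteq> {a..c}" using S(1) unfolding is_partition_def by auto
  have P': "is_partition a b P'" "P \<subseteq> P'"
    unfolding P'_def using partition_refine[OF P(1)] finS by auto
  have Q': "is_partition b c Q'" "Q \<subseteq> Q'"
    unfolding Q'_def using partition_refine[OF Q(1)] finS by auto
  have "S \<subseteq> P' \<union> Q'" unfolding P'_def Q'_def using finS(2) by force
  then have "\<bar>cell_sum g (P' \<union> Q') - K\<bar> < \<epsilon> / 3" using S(2) partition_union[OF P'(1) Q'(1)] by blast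
  moreover have "\<bar>cell_sum g P' - I\<bar> < \<epsilon> / 3" "\<bar>cell_sum g Q' - J\<bar> < \<epsilon> / 3" using P(2) P' Q(2) Q' by auto
  ultimately have "\<bar>cell_sum g P' - I\<bar> + \<bar>cell_sum g Q' - J\<bar> + \<bar>cell_sum g P' + cell_sum g Q' - K\<bar>
      < \<epsilon> / 3 + \<epsilon> / 3 + \<epsilon> / 3"
    unfolding cell_sum_join[OF P'(1) Q'(1)] by (intro add_strict_mono)
  moreover have "\<bar>K - (I + J)\<bar> \<le> \<bar>p - I\<bar> + \<bar>q - J\<bar> + \<bar>p + q - K\<bar>" for p q
    by (simp add: abs_if)
  ultimately have "\<bar>K - (I + J)\<bar> < \<epsilon> / 3 + \<epsilon> / 3 + \<epsilon> / 3" using le_less_trans by blast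
  then show "\<bar>K - (I + J)\<bar> < \<epsilon>" by simp
qed

lemma riemann_integral_upper_bound:
  assumes I: "has_riemann_integral a b f I" and k: "\<And>x. x \<in> {a..b} \<Longrightarrow> f x \<le> k"
  shows "I \<le> k * (b - a)"
proof (rule field_le_epsilon)
  fix \<epsilon> :: 'a assume "\<epsilon> > 0"
  then obtain P where P: "is_partition a b P" "\<bar>cell_sum (\<lambda>u v. f v * (v - u)) P - I\<bar> < \<epsilon>"
    using riemann_integral_cell_sums[OF I] by blast
  have "cell_sum (\<lambda>u v. f v * (v - u)) P \<le> cell_sum (\<lambda>u v. k * (v - u)) P"
    using k by (intro cell_sum_mono[OF P(1)] mult_right_mono) auto
  also have "\<dots> = k * (b - a)" using cell_sum_telescope[OF P(1)] .
  finally have "cell_sum (\<lambda>u v. f v * (v - u)) P \<le> k * (b - a)" .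
  moreover have "I < cell_sum (\<lambda>u v. f v * (v - u)) P + \<epsilon>"
    using P(2) by (simp add: abs_less_iff algebra_simps)
  ultimately show "I \<le> k * (b - a) + \<epsilon>" by (meson add_right_mono less_imp_le order_trans)
qed

lemma has_riemann_integral_uminus:
  assumes "has_riemann_integral a b f I"
  shows "has_riemann_integral a b (\<lambda>x. - f x) (- I)"
  unfolding has_riemann_integral_def
proof (intro allI impI)
  fix \<epsilon> :: 'a assume "\<epsilon> > 0"
  then obtain \<Delta> where \<Delta>: "is_partition a b \<Delta>" "riemann_sums_beyond a b f \<Delta> \<subseteq> {I - \<epsilon><..<I + \<epsilon>}"
    using assms unfolding has_riemann_integral_def by blast
  have neg: "riemann_sum (\<lambda>x. - f x) P \<xi> = - riemann_sum f P \<xi>" for P \<xi>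
    unfolding riemann_sum_def by (simp add: sum_negf)
  have "- riemann_sum f P \<xi> \<in> {- I - \<epsilon><..<- I + \<epsilon>}"
    if "is_partition a b P" "is_tagging P \<xi>" "\<Delta> \<subseteq> P" for P \<xi>
  proof -
    have "riemann_sum f P \<xi> \<in> {I - \<epsilon><..<I + \<epsilon>}" using \<Delta>(2) that unfolding riemann_sums_beyond_def by blast
    then show ?thesis by (auto simp: algebra_simps)
  qed
  then have "riemann_sums_beyond a b (\<lambda>x. - f x) \<Delta> \<subseteq> {- I - \<epsilon><..<- I + \<epsilon>}"
    unfolding riemann_sums_beyond_def neg by blast
  then show "\<exists>\<Delta>. is_partition a b \<Delta> \<and>
      riemann_sums_beyond a b (\<lambda>x. - f x) \<Delta> \<subseteq> {- I - \<epsilon><..<- I + \<epsilon>}" using \<Delta>(1) by blast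
qed

lemma riemann_integral_lower_bound:
  assumes "has_riemann_integral a b f I" "\<And>x. x \<in> {a..b} \<Longrightarrow> k \<le> f x"
  shows "k * (b - a) \<le> I"
  using riemann_integral_upper_bound[OF has_riemann_integral_uminus[OF assms(1)], of "- k"] assms(2)
  by simp

lemma has_riemann_integral_point: "has_riemann_integral a a f 0"
  unfolding has_riemann_integral_def
proof (intro allI impI exI conjI)
  fix \<epsilon> :: 'a assume "\<epsilon> > 0"
  show "is_partition a a {a}" unfolding is_partition_def by simp
  have "riemann_sum f P \<xi> = 0" if "is_partition a a P" for P \<xi>
  proof -
    have "P = {a}" using that unfolding is_partition_def by auto
    then show ?thesis unfolding riemann_sum_def by simp
  qed
  then show "riemann_sums_beyond a a f {a} \<subseteq> {0 - \<epsilon><..<0 + \<epsilon>}"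
    using \<open>\<epsilon> > 0\<close> unfolding riemann_sums_beyond_def by auto
qed

text \<open>Uniqueness is the case of additivity in which the second interval is a point.\<close>

lemma has_riemann_integral_unique:
  assumes "has_riemann_integral a b f I" "has_riemann_integral a b f J"
  shows "I = J"
  using riemann_integral_additive[OF assms(1) has_riemann_integral_point assms(2)] by simp

lemma riemann_integral_eq: "has_riemann_integral a b f I \<Longrightarrow> riemann_integral a b f = I"
  unfolding riemann_integral_def using has_riemann_integral_unique by blast

text \<open>The suprema for \<open>f\<close> and for \<open>- f\<close> are both Riemann integrals, so the upper and the lower
  integral agree by uniqueness.\<close>

lemma complete_imp_RIT:
  assumes C: "dedekind_complete TYPE('a::linordered_field)"
  shows "RIT TYPE('a)"
  unfolding RIT_def
proof (intro allI impI)
  fix a b :: 'a and f assume H: "a \<le> b \<and> cont_on {a..b} f"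
  then have H': "a \<le> b" "cont_on {a..b} f" "cont_on {a..b} (\<lambda>x. - f x)" using cont_on_uminus by blast+
  obtain I where I: "has_lower_integral a b f I" using complete_imp_DIT[OF C] H' unfolding DIT_def by blast
  obtain J where J: "has_lower_integral a b (\<lambda>x. - f x) J"
    using complete_imp_DIT[OF C] H' unfolding DIT_def by blast
  have "J = - I"
    using has_riemann_integral_unique[OF lower_integral_is_riemann_integral[OF C H'(1,3) J]
      has_riemann_integral_uminus[OF lower_integral_is_riemann_integral[OF C H'(1,2) I]]] .
  then have "has_upper_integral a b f I"
    using J unfolding has_upper_integral_def has_lower_integral_def by force
  then show "riemann_integrable a b f" using I unfolding riemann_integrable_def by blast
qed

section \<open>The Fundamental Theorem of Calculus\<close>

text \<open>By additivity the difference quotient of \<open>x \<mapsto> \<integral>\<^sub>a\<^sup>x f\<close> is the mean value of \<open>f\<close> over the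
  interval between \<open>c\<close> and \<open>x\<close>, and this lies between any bounds for \<open>f\<close> on that interval.\<close>

lemma complete_imp_FTC1:
  assumes C: "dedekind_complete TYPE('a::linordered_field)"
  shows "FTC1 TYPE('a)"
  unfolding FTC1_def
proof (intro allI impI)
  fix a b :: 'a and f assume H: "a < b \<and> cont_on {a..b} f"
  have ex: "\<exists>I. has_riemann_integral u v f I" if "a \<le> u" "u \<le> v" "v \<le> b" for u v
    using riemann_integral_exists[OF C that(2)] cont_on_subset[of "{a..b}" f "{u..v}"] H that by auto
  define F where "F x = riemann_integral a x f" for x
  have F: "has_riemann_integral a x f (F x)" if "x \<in> {a..b}" for x
    using ex[of a x] that riemann_integral_eq unfolding F_def by fastforce
  have "has_deriv_on {a..b} F c (f c)" if c: "c \<in> {a..b}" for c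
    unfolding has_deriv_on_def
  proof (intro allI impI)
    fix \<epsilon> :: 'a assume "\<epsilon> > 0"
    then have e2: "\<epsilon> / 2 > 0" "\<epsilon> / 2 < \<epsilon>" by simp_all
    obtain \<delta> where \<delta>: "\<delta> > 0" "\<And>x. x \<in> {a..b} \<Longrightarrow> \<bar>x - c\<bar> < \<delta> \<Longrightarrow> \<bar>f x - f c\<bar> < \<epsilon> / 2"
      using H c e2(1) unfolding cont_on_def by metis
    have "\<bar>(F x - F c) / (x - c) - f c\<bar> < \<epsilon>" if x: "x \<in> {a..b}" "0 < \<bar>x - c\<bar>" "\<bar>x - c\<bar> < \<delta>" for x
    proof -
      define u where "u = min x c"
      define v where "v = max x c"
      have uv: "a \<le> u" "u < v" "v \<le> b" "u \<in> {a..b}" "v \<in> {a..b}"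
        using x(1,2) c unfolding u_def v_def by (auto simp: min_def max_def)
      obtain J where J: "has_riemann_integral u v f J" using ex[of u v] uv by auto
      have FJ: "F v = F u + J" using riemann_integral_additive[OF F[OF uv(4)] J F[OF uv(5)]] .
      have near: "\<bar>f y - f c\<bar> < \<epsilon> / 2" if "y \<in> {u..v}" for y
      proof -
        have "y \<in> {a..b}" using that uv by auto
        moreover have "\<bar>y - c\<bar> \<le> \<bar>x - c\<bar>"
          using that unfolding u_def v_def by (auto simp: min_def max_def abs_if split: if_splits)
        ultimately show ?thesis using \<delta>(2) x(3) by (meson le_less_trans)
      qed
      have up: "f y \<le> f c + \<epsilon> / 2" if "y \<in> {u..v}" for y
      proof -
        have "f y - f c \<le> \<epsilon> / 2" using near[OF that] abs_ge_self by (meson le_less_trans less_imp_le)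
        then show ?thesis by (simp only: diff_le_eq add.commute)
      qed
      have lo: "f c - \<epsilon> / 2 \<le> f y" if "y \<in> {u..v}" for y
      proof -
        have "- (f y - f c) \<le> \<epsilon> / 2"
          using near[OF that] abs_ge_minus_self by (meson le_less_trans less_imp_le)
        then show ?thesis by (simp only: minus_diff_eq diff_le_eq add.commute)
      qed
      have "J / (v - u) \<le> f c + \<epsilon> / 2"
        using riemann_integral_upper_bound[OF J up] uv(2) by (simp add: pos_divide_le_eq)
      moreover have "f c - \<epsilon> / 2 \<le> J / (v - u)"
        using riemann_integral_lower_bound[OF J lo] uv(2) by (simp add: pos_le_divide_eq)
      ultimately have "\<bar>J / (v - u) - f c\<bar> \<le> \<epsilon> / 2"
        unfolding abs_le_iff minus_diff_eq diff_le_eq by (simp only: add.commute conj_commute)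
      moreover have "(F x - F c) / (x - c) = J / (v - u)"
      proof (cases "c \<le> x")
        case True
        then show ?thesis using FJ unfolding u_def v_def by (simp add: min_def max_def)
      next
        case False
        then have "F x - F c = - J" "x - c = - (v - u)"
          using FJ unfolding u_def v_def by (simp_all add: min_def max_def)
        then show ?thesis by (simp only: minus_divide_divide)
      qed
      ultimately show ?thesis using e2(2) by simp
    qed
    then show "\<exists>\<delta>>0. \<forall>x\<in>{a..b}. 0 < \<bar>x - c\<bar> \<and> \<bar>x - c\<bar> < \<delta> \<longrightarrow>
        \<bar>(F x - F c) / (x - c) - f c\<bar> < \<epsilon>" using \<delta>(1) by blast
  qed
  then have "antiderivative_on a b F f" unfolding antiderivative_on_def by blast
  then show "(\<forall>x\<in>{a..b}. \<exists>I. has_riemann_integral a x f I) \<and>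
      antiderivative_on a b (\<lambda>x. riemann_integral a x f) f"
    using F unfolding F_def by blast
qed

text \<open>\<open>F\<close> and the integral function are antiderivatives of the same function, so they differ by a
  constant.\<close>

lemma complete_imp_FTC2:
  assumes C: "dedekind_complete TYPE('a::linordered_field)"
  shows "FTC2 TYPE('a)"
  unfolding FTC2_def
proof (intro allI impI)
  fix a b :: 'a and f F assume H: "a \<le> b \<and> cont_on {a..b} f \<and> antiderivative_on a b F f"
  show "(\<exists>I. has_riemann_integral a b f I) \<and> riemann_integral a b f = F b - F a"
  proof (cases "a = b")
    case True
    then show ?thesis using has_riemann_integral_point[of a f] riemann_integral_eq by fastforce
  next
    case False
    then have ab: "a < b" using H by simp
    have ex: "\<exists>I. has_riemann_integral a b f I" using riemann_integral_exists[OF C] H by blast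
    have "antiderivative_on a b (\<lambda>x. riemann_integral a x f) f"
      using complete_imp_FTC1[OF C] ab H unfolding FTC1_def by blast
    then obtain k where k: "\<And>x. x \<in> {a..b} \<Longrightarrow> F x - riemann_integral a x f = k"
      using MVT_imp_ADT[OF complete_imp_MVT[OF C]] H unfolding ADT_def by blast
    have "riemann_integral a a f = 0" using riemann_integral_eq[OF has_riemann_integral_point] .
    then have "riemann_integral a b f = F b - F a" using k[of a] k[of b] ab by (simp add: algebra_simps)
    then show ?thesis using ex by blast
  qed
qed

lemma has_riemann_integral_zero:
  assumes "a \<le> b"
  shows "has_riemann_integral a b (\<lambda>x. 0) 0"
  unfolding has_riemann_integral_def
proof (intro allI impI exI conjI)
  fix \<epsilon> :: 'a assume "\<epsilon> > 0"
  show "is_partition a b {a, b}" using assms unfolding is_partition_def by auto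
  show "riemann_sums_beyond a b (\<lambda>x. 0) {a, b} \<subseteq> {0 - \<epsilon><..<0 + \<epsilon>}"
    using \<open>\<epsilon> > 0\<close> unfolding riemann_sums_beyond_def riemann_sum_def by auto
qed

lemma FTC2_imp_complete:
  assumes "FTC2 TYPE('a::linordered_field)"
  shows "dedekind_complete TYPE('a)"
proof (rule ccontr)
  assume "\<not> ?thesis"
  then obtain A :: "'a set" where A: "gap A" using not_complete_imp_gap by blast
  obtain a b where ab: "a \<in> A" "b \<notin> A" "a < b" using gap_endpoints[OF A] .
  have "riemann_integral a b (\<lambda>x. 0) = jump A b - jump A a"
    using assms ab(3) cont_on_const[of "{a..b}" 0] jump_antiderivative[OF A, of a b]
    unfolding FTC2_def by (metis order_less_imp_le)
  moreover have "riemann_integral a b (\<lambda>x. 0) = 0"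
    by (rule riemann_integral_eq[OF has_riemann_integral_zero[OF less_imp_le[OF ab(3)]]])
  ultimately show False using ab by (simp add: jump_def)
qed

section \<open>The equivalence of the principles\<close>

theorem theorem82:
  "(UAS TYPE('a::linordered_field) \<longleftrightarrow> CC TYPE('a) \<and> DIT TYPE('a)) \<and>
   (UAS TYPE('a) \<longleftrightarrow> CC TYPE('a) \<and> RIT TYPE('a)) \<and>
   (UAS TYPE('a) \<longleftrightarrow> CC TYPE('a) \<and> BVT TYPE('a)) \<and>
   (UAS TYPE('a) \<longleftrightarrow> MVT TYPE('a)) \<and>
   (UAS TYPE('a) \<longleftrightarrow> FTC1 TYPE('a) \<and> IAT TYPE('a)) \<and>
   (UAS TYPE('a) \<longleftrightarrow> FTC2 TYPE('a)) \<and>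
   (UAS TYPE('a) \<longleftrightarrow> ADT TYPE('a)) \<and>
   (UAS TYPE('a) \<longleftrightarrow> CVT TYPE('a))"
proof -
  let ?C = "dedekind_complete TYPE('a)"
  have uas: "UAS TYPE('a) \<longleftrightarrow> ?C" using UAS_imp_complete complete_imp_UAS by blast
  have bvt: "CC TYPE('a) \<and> BVT TYPE('a) \<longleftrightarrow> ?C"
    using CC_BVT_imp_complete complete_imp_CC complete_imp_BVT by blast
  have dit: "CC TYPE('a) \<and> DIT TYPE('a) \<longleftrightarrow> ?C" using bvt DIT_imp_BVT complete_imp_DIT by blast
  have rit: "CC TYPE('a) \<and> RIT TYPE('a) \<longleftrightarrow> ?C" using dit RIT_imp_DIT complete_imp_RIT by blast
  have mvt: "MVT TYPE('a) \<longleftrightarrow> ?C" using MVT_imp_complete complete_imp_MVT by blast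
  have ftc1: "FTC1 TYPE('a) \<and> IAT TYPE('a) \<longleftrightarrow> ?C"
    using IAT_imp_complete complete_imp_FTC1 mvt MVT_imp_IAT by blast
  have ftc2: "FTC2 TYPE('a) \<longleftrightarrow> ?C" using FTC2_imp_complete complete_imp_FTC2 by blast
  have adt: "ADT TYPE('a) \<longleftrightarrow> ?C" using ADT_imp_complete mvt MVT_imp_ADT by blast
  have cvt: "CVT TYPE('a) \<longleftrightarrow> ?C" using CVT_imp_complete mvt MVT_imp_CVT by blast
  show ?thesis unfolding uas bvt dit rit mvt ftc1 ftc2 adt cvt by blast
qed

end
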